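(* Let $H$ be a Hopf algebra over $k$. Suppose the subgroup $\langle W\setminus W_{\sqrt{\;}}\rangle$ of $G(H)$ is abelian. Then $$\operatorname{GKdim} H\geq \operatorname{GKdim} C_0+\#(W\setminus W_{\sqrt{\;}}).$$
   Context: $k$ is an algebraically closed field of characteristic zero and everything is over $k$. $G(H)$ is the group of group-like elements of $H$ and $C_0=kG(H)$ is its linear span. A nonzero element $y\in H$ is called skew primitive (always meaning $(1,g)$-primitive) if $\Delta(y)=y\otimes 1+g\otimes y$ for some $g$; then $g$ is group-like and uniquely determined, is called the weight of $y$, and is denoted $\mu(y)$. $W$ is the set of weights $\mu(y)$ of all skew primitive elements $y\in H$ with $y\notin C_0$. $W_{\sqrt{\;}}$ is the subset of $W$ consisting of the weights $\mu(y)$ of all skew primitive $y\notin C_0$ such that $y^n$ is also skew primitive for some $n>1$; here the case $y^n=0$ counts as $y^n$ being skew primitive. For $\Phi\subset G(H)$, $\langle\Phi\rangle$ is the subgroup of $G(H)$ generated by $\Phi$. $\operatorname{GKdim}$ is Gelfand-Kirillov dimension, with values in $[0,\infty]$; an infinite cardinality $\#$ is read as $\infty$. *)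

theory Defs
  imports
    Complex_Main
    "HOL-Library.Poly_Mapping"
    "HOL-Library.Extended_Real"
    "HOL-Library.Liminf_Limsup"
    "HOL-Computational_Algebra.Polynomial"
    "HOL-Algebra.Generated_Groups"
begin

subsection \<open>Formal sums and tensor products\<close>

text \<open>
  The vector space \<open>'a \<Rightarrow>\<^sub>0 'k\<close> of finitely supported functions is the free vector space on \<open>'a\<close>.
  A tensor product is its quotient by the usual multilinear relations.  Elements of the tensor
  product are handled through representatives (formal sums of pure tensors), and equality in the
  tensor product is the congruence \<open>t - u \<in> span relations\<close>.
\<close>

definition free_scale :: "'k::field \<Rightarrow> ('b \<Rightarrow>\<^sub>0 'k) \<Rightarrow> ('b \<Rightarrow>\<^sub>0 'k)" where
  "free_scale c = Poly_Mapping.map ((*) c)"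

lemma lookup_free_scale: "Poly_Mapping.lookup (free_scale c t) p = c * Poly_Mapping.lookup t p"
  by (simp add: free_scale_def Poly_Mapping.map.rep_eq when_def)

lemma vector_space_free_scale: "vector_space (free_scale :: 'k::field \<Rightarrow> ('b \<Rightarrow>\<^sub>0 'k) \<Rightarrow> _)"
  by unfold_locales
    (auto intro!: poly_mapping_eqI simp: lookup_free_scale lookup_add algebra_simps)

text \<open>Linear extension of \<open>f\<close> from the basis to formal sums, with values in the space with
  scalar multiplication \<open>s\<close>.\<close>

definition lin_ext ::
  "('k::field \<Rightarrow> 'v \<Rightarrow> 'v::ab_group_add) \<Rightarrow> ('b \<Rightarrow> 'v) \<Rightarrow> ('b \<Rightarrow>\<^sub>0 'k) \<Rightarrow> 'v" where
  "lin_ext s f t = (\<Sum>p\<in>Poly_Mapping.keys t. s (Poly_Mapping.lookup t p) (f p))"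

definition tens :: "'a \<Rightarrow> 'b \<Rightarrow> ('a \<times> 'b \<Rightarrow>\<^sub>0 'k::field)" where
  "tens a b = Poly_Mapping.single (a, b) 1"

definition tens3 :: "'a \<Rightarrow> 'b \<Rightarrow> 'c \<Rightarrow> ('a \<times> 'b \<times> 'c \<Rightarrow>\<^sub>0 'k::field)" where
  "tens3 a b c = Poly_Mapping.single (a, b, c) 1"

definition tensor_relations ::
  "('k::field \<Rightarrow> 'a \<Rightarrow> 'a::ab_group_add) \<Rightarrow> ('a \<times> 'a \<Rightarrow>\<^sub>0 'k) set" where
  "tensor_relations s =
     {tens (a + a') b - tens a b - tens a' b | a a' b. True} \<union>
     {tens a (b + b') - tens a b - tens a b' | a b b'. True} \<union>
     {tens (s r a) b - free_scale r (tens a b) | r a b. True} \<union>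
     {tens a (s r b) - free_scale r (tens a b) | r a b. True}"

definition tensor3_relations ::
  "('k::field \<Rightarrow> 'a \<Rightarrow> 'a::ab_group_add) \<Rightarrow> ('a \<times> 'a \<times> 'a \<Rightarrow>\<^sub>0 'k) set" where
  "tensor3_relations s =
     {tens3 (a + a') b c - tens3 a b c - tens3 a' b c | a a' b c. True} \<union>
     {tens3 a (b + b') c - tens3 a b c - tens3 a b' c | a b b' c. True} \<union>
     {tens3 a b (c + c') - tens3 a b c - tens3 a b c' | a b c c'. True} \<union>
     {tens3 (s r a) b c - free_scale r (tens3 a b c) | r a b c. True} \<union>
     {tens3 a (s r b) c - free_scale r (tens3 a b c) | r a b c. True} \<union>
     {tens3 a b (s r c) - free_scale r (tens3 a b c) | r a b c. True}"

definition tensor_eq ::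
  "('k::field \<Rightarrow> 'a \<Rightarrow> 'a::ab_group_add) \<Rightarrow> ('a \<times> 'a \<Rightarrow>\<^sub>0 'k) \<Rightarrow> ('a \<times> 'a \<Rightarrow>\<^sub>0 'k) \<Rightarrow> bool" where
  "tensor_eq s t u \<longleftrightarrow> t - u \<in> module.span free_scale (tensor_relations s)"

definition tensor3_eq ::
  "('k::field \<Rightarrow> 'a \<Rightarrow> 'a::ab_group_add) \<Rightarrow>
     ('a \<times> 'a \<times> 'a \<Rightarrow>\<^sub>0 'k) \<Rightarrow> ('a \<times> 'a \<times> 'a \<Rightarrow>\<^sub>0 'k) \<Rightarrow> bool" where
  "tensor3_eq s t u \<longleftrightarrow> t - u \<in> module.span free_scale (tensor3_relations s)"

text \<open>The product \<open>(a \<otimes> b)(c \<otimes> d) = ac \<otimes> bd\<close>, extended bilinearly.\<close>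

definition tensor_mult ::
  "('a::ring_1 \<times> 'a \<Rightarrow>\<^sub>0 'k::field) \<Rightarrow> ('a \<times> 'a \<Rightarrow>\<^sub>0 'k) \<Rightarrow> ('a \<times> 'a \<Rightarrow>\<^sub>0 'k)" where
  "tensor_mult t u =
     lin_ext free_scale (\<lambda>(a, b). lin_ext free_scale (\<lambda>(c, d). tens (a * c) (b * d)) u) t"


subsection \<open>Algebras and Gelfand--Kirillov dimension\<close>

locale assoc_algebra = vector_space scale
  for scale :: "'k::field \<Rightarrow> 'a::ring_1 \<Rightarrow> 'a" +
  assumes scale_mult_left: "scale r x * y = scale r (x * y)"
    and scale_mult_right: "x * scale r y = scale r (x * y)"
begin

text \<open>\<open>k + V + V\<^sup>2 + \<dots> + V\<^sup>n\<close>\<close>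

definition power_span :: "'a set \<Rightarrow> nat \<Rightarrow> 'a set" where
  "power_span V n = span {prod_list ws | ws. set ws \<subseteq> V \<and> length ws \<le> n}"

text \<open>\<open>GKdim A\<close> is meant for subalgebras \<open>A\<close> (containing the unit); \<open>V\<close> ranges over the
  finite-dimensional subspaces of \<open>A\<close>, for which all \<open>power_span V n\<close> are finite-dimensional and
  nonzero.\<close>

definition GKdim :: "'a set \<Rightarrow> ereal" where
  "GKdim A =
     (SUP V\<in>{V. V \<subseteq> A \<and> (\<exists>B. finite B \<and> V = span B)}.
        limsup (\<lambda>n. ereal (ln (real (dim (power_span V n))) / ln (real n))))"

end


subsection \<open>Hopf algebras\<close>

text \<open>
  \<open>\<Delta> x\<close> is a chosen representative, as a formal sum \<open>\<Sum> x\<^sub>1 \<otimes> x\<^sub>2\<close>, of the comultiplication of \<open>x\<close>.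
  The comultiplication itself is the composition of \<open>\<Delta>\<close> with the quotient map to the tensor
  product, and all axioms and all notions below depend on that composition only.
\<close>

locale hopf_algebra = assoc_algebra scale
  for scale :: "'k::field \<Rightarrow> 'a::ring_1 \<Rightarrow> 'a" +
  fixes \<Delta> :: "'a \<Rightarrow> ('a \<times> 'a \<Rightarrow>\<^sub>0 'k)"
    and \<epsilon> :: "'a \<Rightarrow> 'k"
    and S :: "'a \<Rightarrow> 'a"
  assumes comult_add: "tensor_eq scale (\<Delta> (x + y)) (\<Delta> x + \<Delta> y)"
    and comult_scale: "tensor_eq scale (\<Delta> (scale r x)) (free_scale r (\<Delta> x))"
    and comult_mult: "tensor_eq scale (\<Delta> (x * y)) (tensor_mult (\<Delta> x) (\<Delta> y))"
    and comult_one: "tensor_eq scale (\<Delta> 1) (tens 1 1)"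
    and counit_linear: "Vector_Spaces.linear scale (*) \<epsilon>"
    and counit_mult: "\<epsilon> (x * y) = \<epsilon> x * \<epsilon> y"
    and counit_one: "\<epsilon> 1 = 1"
    and antipode_linear: "Vector_Spaces.linear scale scale S"
    \<comment> \<open>\<open>(\<Delta> \<otimes> id) \<circ> \<Delta> = (id \<otimes> \<Delta>) \<circ> \<Delta>\<close>\<close>
    and coassoc: "tensor3_eq scale
        (lin_ext free_scale
           (\<lambda>(a, b). lin_ext free_scale (\<lambda>(a\<^sub>1, a\<^sub>2). tens3 a\<^sub>1 a\<^sub>2 b) (\<Delta> a)) (\<Delta> x))
        (lin_ext free_scale
           (\<lambda>(a, b). lin_ext free_scale (\<lambda>(b\<^sub>1, b\<^sub>2). tens3 a b\<^sub>1 b\<^sub>2) (\<Delta> b)) (\<Delta> x))"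
    and counit_left: "lin_ext scale (\<lambda>(a, b). scale (\<epsilon> a) b) (\<Delta> x) = x"
    and counit_right: "lin_ext scale (\<lambda>(a, b). scale (\<epsilon> b) a) (\<Delta> x) = x"
    and antipode_left: "lin_ext scale (\<lambda>(a, b). S a * b) (\<Delta> x) = scale (\<epsilon> x) 1"
    and antipode_right: "lin_ext scale (\<lambda>(a, b). a * S b) (\<Delta> x) = scale (\<epsilon> x) 1"
begin

definition grouplikes :: "'a set" where
  "grouplikes = {g. g \<noteq> 0 \<and> tensor_eq scale (\<Delta> g) (tens g g)}"

definition grouplike_group :: "'a monoid" where
  "grouplike_group = \<lparr>carrier = grouplikes, mult = (*), one = 1\<rparr>"

definition C0 :: "'a set" where
  "C0 = span grouplikes"

definition has_weight :: "'a \<Rightarrow> 'a \<Rightarrow> bool" where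
  "has_weight y g \<longleftrightarrow> tensor_eq scale (\<Delta> y) (tens y 1 + tens g y)"

text \<open>The defining equation forces \<open>g\<close> to be group-like except when \<open>y\<close> is a scalar (then \<open>g = 0\<close>
  is a solution).  Scalars lie in \<open>C0\<close>, and a power of a skew primitive element outside \<open>C0\<close> has
  counit \<open>0\<close>, so this case does not affect the two sets of weights below.\<close>

definition skew_primitive :: "'a \<Rightarrow> bool" where
  "skew_primitive y \<longleftrightarrow> y \<noteq> 0 \<and> (\<exists>g. has_weight y g)"

definition weight :: "'a \<Rightarrow> 'a" where
  "weight y = (THE g. has_weight y g)"

definition weights :: "'a set" where
  "weights = {weight y | y. skew_primitive y \<and> y \<notin> C0}"

definition root_weights :: "'a set" where
  "root_weights =
     {weight y | y. skew_primitive y \<and> y \<notin> C0 \<and> (\<exists>n>1. y ^ n = 0 \<or> skew_primitive (y ^ n))}"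

end

definition ext_card :: "'a set \<Rightarrow> ereal" where
  "ext_card A = (if finite A then ereal (real (card A)) else \<infinity>)"

end

theory Submission
  imports Defs "HOL-Analysis.Extended_Real_Limits" "HOL-Real_Asymp.Real_Asymp"
begin

text \<open>
  The bound comes from exhibiting many linearly independent products.  Let \<open>g\<^sub>1, \<dots>, g\<^sub>m\<close> be distinct
  weights outside \<open>root_weights\<close>, and suppose that there are skew primitive \<open>y\<^sub>i \<notin> C0\<close> of weight \<open>g\<^sub>i\<close>
  that are eigenvectors modulo \<open>C0\<close> for conjugation by every \<open>g\<^sub>j\<close>, with eigenvalues \<open>q\<^sub>i\<^sub>j\<close>.  Then the
  products of a group-like with an ordered monomial \<open>y\<^sub>1\<^sup>a \<cdots> y\<^sub>m\<^sup>b\<close> are linearly independent.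
  There are \<open>(n + 1)\<^sup>m\<close> monomials with all exponents at most \<open>n\<close>, so adjoining the \<open>y\<^sub>i\<close> to
  finitely many group-likes multiplies the growth by \<open>n\<^sup>m\<close>, and the Gelfand--Kirillov dimension goes up
  by at least \<open>m\<close> (\<open>GKdim_ge_monomials\<close>).

  Independence is read off from the coproduct.  If a linear functional \<open>h\<close> vanishes on \<open>C0\<close>, then the
  operator \<open>slice h = (id \<otimes> h) \<circ> \<Delta>\<close> removes a skew primitive factor: modulo products with fewer such
  factors, it sends a monomial to a combination of the monomials with one letter deleted
  (\<open>slice_monomial\<close>).  Induction on the degree gives the independence (\<open>indep_graded\<close>), provided that
  the coefficients produced on the way are nonzero.  These coefficients are, up to units, the
  \<open>q\<close>-integers \<open>1 + q + \<cdots> + q\<^sup>a\<close> for \<open>q = q\<^sub>i\<^sub>i\<close>.  In characteristic zero they vanish only if \<open>q\<close> is a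
  nontrivial root of unity, and then the \<open>q\<close>-binomial theorem makes a power of \<open>y\<^sub>i\<close> skew primitive or
  zero, which puts \<open>g\<^sub>i\<close> into \<open>root_weights\<close> (\<open>eigenvalue_not_root_of_unity\<close>).

  It remains to find eigenvectors.  The weights in question commute, so conjugation by one of them
  preserves the skew primitives of each weight.  Over an algebraically closed field there is an
  eigenvector unless some orbit \<open>y, u\<^sup>-\<^sup>1 y u, u\<^sup>-\<^sup>2 y u\<^sup>2, \<dots>\<close> is linearly independent modulo \<open>C0\<close>
  (\<open>eigenvector_mod\<close>).  In that case the argument above, applied to products of orbit elements with
  strictly increasing indices below \<open>n\<close>, yields \<open>2\<^sup>n\<close> independent words of length at most \<open>3n\<close> in
  \<open>u\<^sup>-\<^sup>1\<close>, \<open>y\<close> and \<open>u\<close>, so the dimension is infinite and the bound is trivial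
  (\<open>GKdim_infinite_orbit\<close>).  Both situations are instances of the locale \<open>skew_family\<close>.
\<close>

section \<open>Linear maps out of tensor products\<close>

interpretation free: vector_space "free_scale :: 'k::field \<Rightarrow> ('b \<Rightarrow>\<^sub>0 'k) \<Rightarrow> _"
  by (rule vector_space_free_scale)

context vector_space
begin

lemma lin_ext_superset:
  assumes "finite A" "Poly_Mapping.keys t \<subseteq> A"
  shows "lin_ext scale f t = (\<Sum>p\<in>A. scale (Poly_Mapping.lookup t p) (f p))"
  unfolding lin_ext_def using assms
  by (intro sum.mono_neutral_left) (auto simp: in_keys_iff)

lemma lin_ext_add: "lin_ext scale f (t + u) = lin_ext scale f t + lin_ext scale f u"
proof -
  define A where "A = Poly_Mapping.keys t \<union> Poly_Mapping.keys u"
  have "finite A" "Poly_Mapping.keys (t + u) \<subseteq> A" "Poly_Mapping.keys t \<subseteq> A" "Poly_Mapping.keys u \<subseteq> A"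
    using keys_add[of t u] by (auto simp: A_def)
  then show ?thesis
    by (simp add: lin_ext_superset[of A] lookup_add scale_left_distrib sum.distrib)
qed

lemma lin_ext_free_scale: "lin_ext scale f (free_scale r t) = scale r (lin_ext scale f t)"
proof -
  have "Poly_Mapping.keys (free_scale r t) \<subseteq> Poly_Mapping.keys t"
    by (auto simp: in_keys_iff lookup_free_scale)
  then show ?thesis
    by (simp add: lin_ext_superset[of "Poly_Mapping.keys t"] lookup_free_scale scale_sum_right)
qed

lemma linear_lin_ext: "Vector_Spaces.linear free_scale scale (lin_ext scale f)"
  by unfold_locales (simp_all add: lin_ext_add lin_ext_free_scale)

lemma lin_ext_diff: "lin_ext scale f (t - u) = lin_ext scale f t - lin_ext scale f u"
proof -
  interpret Vector_Spaces.linear free_scale scale "lin_ext scale f" by (rule linear_lin_ext)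
  show ?thesis by (rule diff)
qed

lemma lin_ext_zero: "lin_ext scale f 0 = 0"
  by (simp add: lin_ext_def)

lemma lin_ext_sum: "lin_ext scale f (\<Sum>i\<in>I. t i) = (\<Sum>i\<in>I. lin_ext scale f (t i))"
  by (induction I rule: infinite_finite_induct) (auto simp: lin_ext_zero lin_ext_add)

lemma lin_ext_single: "lin_ext scale f (Poly_Mapping.single p 1) = f p"
  by (simp add: lin_ext_def)

lemma lin_ext_tens: "lin_ext scale f (tens a b) = f (a, b)"
  by (simp add: tens_def lin_ext_single)

lemma lin_ext_tens3: "lin_ext scale f (tens3 a b c) = f (a, b, c)"
  by (simp add: tens3_def lin_ext_single)

lemma lin_ext_fun_add: "lin_ext scale (\<lambda>p. f p + g p) t = lin_ext scale f t + lin_ext scale g t"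
  by (simp add: lin_ext_def scale_right_distrib sum.distrib)

lemma lin_ext_fun_diff: "lin_ext scale (\<lambda>p. f p - g p) t = lin_ext scale f t - lin_ext scale g t"
  by (simp add: lin_ext_def scale_right_diff_distrib sum_subtractf)

lemma lin_ext_fun_scale: "lin_ext scale (\<lambda>p. scale r (f p)) t = scale r (lin_ext scale f t)"
  by (simp add: lin_ext_def scale_sum_right mult.commute)

end

lemma linear_lin_ext_comp:
  assumes "Vector_Spaces.linear s s' L"
  shows "L (lin_ext s f t) = lin_ext s' (\<lambda>p. L (f p)) t"
proof -
  interpret Vector_Spaces.linear s s' L by fact
  show ?thesis by (simp add: lin_ext_def sum scale)
qed

lemma linear_span_into:
  assumes "Vector_Spaces.linear s s' L" "\<And>r. r \<in> R \<Longrightarrow> L r \<in> module.span s' R'"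
    "t \<in> module.span s R"
  shows "L t \<in> module.span s' R'"
proof -
  interpret L: Vector_Spaces.linear s s' L by fact
  have "L.vs1.span R \<subseteq> {x. L x \<in> L.vs2.span R'}"
    by (rule L.vs1.span_minimal) (auto simp: assms(2) intro: L.subspace_linear_preimage)
  then show ?thesis using assms(3) by auto
qed

lemma linear_lin_ext_free: "Vector_Spaces.linear free_scale free_scale (lin_ext free_scale f)"
  by (rule free.linear_lin_ext)

lemmas lin_ext_free_simps = free.lin_ext_add free.lin_ext_diff free.lin_ext_free_scale
  free.lin_ext_tens free.lin_ext_tens3 free.lin_ext_sum free.lin_ext_zero

lemma lin_ext_expand: "lin_ext free_scale (\<lambda>p. Poly_Mapping.single p 1) t = t"
proof (rule poly_mapping_eqI)
  fix k
  have *: "Poly_Mapping.lookup (sum f A) k = (\<Sum>i\<in>A. Poly_Mapping.lookup (f i) k)"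
    for f :: "'a \<Rightarrow> ('a \<Rightarrow>\<^sub>0 'b)" and A
    by (induction A rule: infinite_finite_induct) (auto simp: lookup_add)
  have "Poly_Mapping.lookup (lin_ext free_scale (\<lambda>p. Poly_Mapping.single p 1) t) k
      = (\<Sum>p\<in>Poly_Mapping.keys t. if p = k then Poly_Mapping.lookup t p else 0)"
    unfolding lin_ext_def * by (intro sum.cong) (auto simp: lookup_free_scale lookup_single when_def)
  also have "\<dots> = Poly_Mapping.lookup t k"
    by (simp add: in_keys_iff)
  finally show "Poly_Mapping.lookup (lin_ext free_scale (\<lambda>p. Poly_Mapping.single p 1) t) k
      = Poly_Mapping.lookup t k" .
qed

lemma formal_sum_in_span_tens: "t \<in> free.span {tens a b | a b. True}"
proof -
  have "lin_ext free_scale (\<lambda>p. Poly_Mapping.single p 1) t \<in> free.span {tens a b | a b. True}"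
    unfolding lin_ext_def
    by (intro free.span_sum free.span_scale free.span_base) (auto simp: tens_def)
  then show ?thesis by (simp add: lin_ext_expand)
qed

context assoc_algebra
begin

abbreviation teq (infix "\<doteq>" 50) where "teq \<equiv> tensor_eq scale"

lemma teq_refl [simp]: "t \<doteq> t"
  by (simp add: tensor_eq_def free.span_zero)

lemma teq_sym: "t \<doteq> u \<Longrightarrow> u \<doteq> t"
  unfolding tensor_eq_def by (metis free.span_neg minus_diff_eq)

lemma teq_trans [trans]: "t \<doteq> u \<Longrightarrow> u \<doteq> v \<Longrightarrow> t \<doteq> v"
  unfolding tensor_eq_def
  by (drule (1) free.span_add) (simp add: algebra_simps)

lemma teq_add: "t \<doteq> t' \<Longrightarrow> u \<doteq> u' \<Longrightarrow> t + u \<doteq> t' + u'"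
  unfolding tensor_eq_def by (metis add_diff_add free.span_add)

lemma teq_diff:
  assumes "t \<doteq> t'" "u \<doteq> u'"
  shows "t - u \<doteq> t' - u'"
proof -
  have "(t - u) - (t' - u') = (t - t') - (u - u')" by (simp add: algebra_simps)
  with assms free.span_diff[of "t - t'" _ "u - u'"] show ?thesis
    by (simp only: tensor_eq_def)
qed

lemma teq_scale: "t \<doteq> t' \<Longrightarrow> free_scale r t \<doteq> free_scale r t'"
  unfolding tensor_eq_def by (metis free.scale_right_diff_distrib free.span_scale)

lemma teq_sum: "(\<And>i. i \<in> I \<Longrightarrow> t i \<doteq> u i) \<Longrightarrow> (\<Sum>i\<in>I. t i) \<doteq> (\<Sum>i\<in>I. u i)"
  by (induction I rule: infinite_finite_induct) (auto intro: teq_add)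

lemma teq_tens_add_left: "tens (a + a') b \<doteq> tens a b + tens a' b"
  and teq_tens_add_right: "tens a (b + b') \<doteq> tens a b + tens a b'"
  and teq_tens_scale_left: "tens (scale r a) b \<doteq> free_scale r (tens a b)"
  and teq_tens_scale_right: "tens a (scale r b) \<doteq> free_scale r (tens a b)"
  unfolding tensor_eq_def
  unfolding tensor_relations_def diff_diff_add[symmetric] by (rule free.span_base, blast)+

text \<open>The universal property of the tensor square, for maps into another vector space.\<close>

definition bilinear_map :: "('k \<Rightarrow> 'v \<Rightarrow> 'v::ab_group_add) \<Rightarrow> ('a \<times> 'a \<Rightarrow> 'v) \<Rightarrow> bool" where
  "bilinear_map s f \<longleftrightarrow>
     (\<forall>a a' b. f (a + a', b) = f (a, b) + f (a', b)) \<and> (\<forall>a b b'. f (a, b + b') = f (a, b) + f (a, b')) \<and>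
     (\<forall>r a b. f (scale r a, b) = s r (f (a, b))) \<and> (\<forall>r a b. f (a, scale r b) = s r (f (a, b)))"

lemma lin_ext_teq:
  assumes "vector_space s" "bilinear_map s f" "t \<doteq> u"
  shows "lin_ext s f t = lin_ext s f u"
proof -
  interpret s: vector_space s by fact
  have "lin_ext s f (t - u) \<in> s.span {}"
    by (rule linear_span_into[OF s.linear_lin_ext _ assms(3)[unfolded tensor_eq_def]]) (use assms(2) in
      \<open>auto simp: tensor_relations_def bilinear_map_def s.lin_ext_diff s.lin_ext_tens s.lin_ext_free_scale\<close>)
  then show ?thesis by (simp add: s.lin_ext_diff)
qed

lemma tensor_mult_simps:
  "tensor_mult (tens a b) (tens c d) = tens (a * c) (b * d)"
  "tensor_mult (t + t') u = tensor_mult t u + tensor_mult t' u"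
  "tensor_mult (t - t') u = tensor_mult t u - tensor_mult t' u"
  "tensor_mult t (u + u') = tensor_mult t u + tensor_mult t u'"
  "tensor_mult t (u - u') = tensor_mult t u - tensor_mult t u'"
  "tensor_mult (free_scale r t) u = free_scale r (tensor_mult t u)"
  "tensor_mult t (free_scale r u) = free_scale r (tensor_mult t u)"
proof -
  show "tensor_mult t (u + u') = tensor_mult t u + tensor_mult t u'"
    unfolding tensor_mult_def
    by (simp add: lin_ext_free_simps case_prod_unfold free.lin_ext_fun_add)
  show scale: "tensor_mult t (free_scale r u) = free_scale r (tensor_mult t u)" for r u
    unfolding tensor_mult_def
    by (simp add: lin_ext_free_simps case_prod_unfold free.lin_ext_fun_scale)
  show "tensor_mult t (u - u') = tensor_mult t u - tensor_mult t u'"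
    unfolding tensor_mult_def
    by (simp add: lin_ext_free_simps case_prod_unfold free.lin_ext_fun_diff)
qed (simp_all add: tensor_mult_def lin_ext_free_simps)

lemma tensor_mult_cong:
  assumes "t \<doteq> t'" "u \<doteq> u'"
  shows "tensor_mult t u \<doteq> tensor_mult t' u'"
proof -
  let ?R = "tensor_relations scale"
  have lin_l: "Vector_Spaces.linear free_scale free_scale (\<lambda>t. tensor_mult t u)" for u :: "'a \<times> 'a \<Rightarrow>\<^sub>0 'k"
    by unfold_locales (simp_all add: tensor_mult_simps)
  have lin_r: "Vector_Spaces.linear free_scale free_scale (tensor_mult t)" for t :: "'a \<times> 'a \<Rightarrow>\<^sub>0 'k"
    by unfold_locales (simp_all add: tensor_mult_simps)
  have rel: "r \<in> ?R \<Longrightarrow> tensor_mult r (tens c d) \<in> ?R \<and> tensor_mult (tens c d) r \<in> ?R" for r c d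
    unfolding tensor_relations_def Un_iff mem_Collect_eq
    by (elim disjE; clarify;
        simp add: tensor_mult_simps distrib_left distrib_right scale_mult_left scale_mult_right; blast)
  have "tensor_mult r u \<in> free.span ?R" if "r \<in> ?R" for r u
    by (rule linear_span_into[OF lin_r _ formal_sum_in_span_tens]) (use rel[OF that] in \<open>auto intro: free.span_base\<close>)
  then have 1: "tensor_mult (t - t') u \<in> free.span ?R"
    by (auto intro: linear_span_into[OF lin_l _ assms(1)[unfolded tensor_eq_def]])
  have "tensor_mult t r \<in> free.span ?R" if "r \<in> ?R" for r t
    by (rule linear_span_into[OF lin_l _ formal_sum_in_span_tens]) (use rel[OF that] in \<open>auto intro: free.span_base\<close>)
  then have 2: "tensor_mult t' (u - u') \<in> free.span ?R"
    by (auto intro: linear_span_into[OF lin_r _ assms(2)[unfolded tensor_eq_def]])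
  from free.span_add[OF 1 2] show ?thesis
    by (simp add: tensor_eq_def tensor_mult_simps)
qed

end

section \<open>Linear functionals and linear independence modulo a subspace\<close>

context assoc_algebra
begin

definition functional :: "('a \<Rightarrow> 'k) \<Rightarrow> bool" where
  "functional h \<longleftrightarrow> Vector_Spaces.linear scale (*) h"

lemma vector_space_times: "vector_space ((*) :: 'k \<Rightarrow> 'k \<Rightarrow> 'k)"
  by unfold_locales (simp_all add: algebra_simps)

lemma functionalI:
  "(\<And>x y. h (x + y) = h x + h y) \<Longrightarrow> (\<And>r x. h (scale r x) = r * h x) \<Longrightarrow> functional h"
  unfolding functional_def
  by (intro Vector_Spaces.linear.intro vector_space_times vector_space_axioms module_hom.intro
      module_hom_axioms.intro) (simp_all add: vector_space_axioms vector_space_times module_iff_vector_space)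

lemma functional_add: "functional h \<Longrightarrow> h (x + y) = h x + h y"
  and functional_scale: "functional h \<Longrightarrow> h (scale r x) = r * h x"
  and functional_diff: "functional h \<Longrightarrow> h (x - y) = h x - h y"
  and functional_zero: "functional h \<Longrightarrow> h 0 = 0"
  and functional_sum: "functional h \<Longrightarrow> h (sum f I) = (\<Sum>i\<in>I. h (f i))"
proof -
  assume "functional h"
  then interpret Vector_Spaces.linear scale "(*)" h by (simp add: functional_def)
  show "h (x + y) = h x + h y" "h (scale r x) = r * h x" "h (x - y) = h x - h y" "h 0 = 0"
    "h (sum f I) = (\<Sum>i\<in>I. h (f i))"
    by (rule add scale diff zero sum)+
qed

lemmas functional_simps = functional_add functional_scale functional_diff functional_zero functional_sum

lemma functional_mult_left: "functional h \<Longrightarrow> functional (\<lambda>x. h (y * x))"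
  by (rule functionalI) (simp_all add: distrib_left functional_simps scale_mult_right)

lemma linear_mult: "Vector_Spaces.linear scale scale ((*) a)" "Vector_Spaces.linear scale scale (\<lambda>x. x * a)"
  by (unfold_locales; simp add: distrib_left distrib_right scale_mult_left scale_mult_right)+

lemma separating_functional:
  assumes "v \<notin> span S"
  obtains h where "functional h" "h v = 1" "\<And>x. x \<in> span S \<Longrightarrow> h x = 0"
proof -
  interpret pair: vector_space_pair scale "(*) :: 'k \<Rightarrow> 'k \<Rightarrow> 'k"
    by (intro vector_space_pair.intro vector_space_axioms vector_space_times)
  obtain B where B: "B \<subseteq> S" "independent B" "S \<subseteq> span B"
    by (rule maximal_independent_subset)
  have spB: "span B = span S"
    using B by (metis span_eq span_superset subset_trans)
  then have "v \<notin> B" using assms by (metis span_base)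
  then have "independent (insert v B)"
    using assms B spB by (simp add: independent_insert)
  then obtain h where h: "Vector_Spaces.linear scale (*) h"
    "\<forall>x\<in>insert v B. h x = (if x = v then 1 else 0)"
    using pair.linear_independent_extend[of "insert v B" "\<lambda>x. if x = v then 1 else 0"] by blast
  then interpret Vector_Spaces.linear scale "(*)" h by simp
  have "h x = 0" if "x \<in> span S" for x
    by (rule eq_0_on_span[of B]) (use h \<open>v \<notin> B\<close> that spB in auto)
  with h show ?thesis by (intro that[of h]) (auto simp: functional_def)
qed

lemma span_image_as_sum:
  assumes "x \<in> span (f ` J)"
  shows "\<exists>F c. finite F \<and> F \<subseteq> J \<and> x = (\<Sum>i\<in>F. scale (c i) (f i))"
  using assms
proof (induction rule: span_induct_alt)
  case base
  show ?case by (intro exI[of _ "{}"]) simp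
next
  case (step r y z)
  then obtain F c j where F: "finite F" "F \<subseteq> J" "z = (\<Sum>i\<in>F. scale (c i) (f i))" "j \<in> J" "y = f j"
    by auto
  let ?c = "\<lambda>i. (if i = j then r else 0) + (if i \<in> F then c i else 0)"
  have "(\<Sum>i\<in>insert j F. scale (?c i) (f i))
      = (\<Sum>i\<in>insert j F. scale (if i = j then r else 0) (f i))
        + (\<Sum>i\<in>insert j F. scale (if i \<in> F then c i else 0) (f i))"
    by (simp only: scale_left_distrib sum.distrib)
  also have "(\<Sum>i\<in>insert j F. scale (if i = j then r else 0) (f i))
      = (\<Sum>i\<in>insert j F. if i = j then scale r (f j) else 0)"
    by (intro sum.cong) auto
  also have "\<dots> = scale r (f j)"
    using F(1) by simp
  also have "(\<Sum>i\<in>insert j F. scale (if i \<in> F then c i else 0) (f i)) = (\<Sum>i\<in>F. scale (c i) (f i))"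
    using F(1) by (intro sum.mono_neutral_cong_right) auto
  finally show ?case
    using F by (intro exI[of _ "insert j F"] exI[of _ ?c]) auto
qed

text \<open>Independence is attached to a family rather than to a set of vectors: it includes that the family is
  injective, which is needed when monomials are counted.\<close>

definition indep_mod :: "'a set \<Rightarrow> ('i \<Rightarrow> 'a) \<Rightarrow> 'i set \<Rightarrow> bool" where
  "indep_mod U f I \<longleftrightarrow>
     (\<forall>F c. finite F \<longrightarrow> F \<subseteq> I \<longrightarrow> (\<Sum>i\<in>F. scale (c i) (f i)) \<in> U \<longrightarrow> (\<forall>i\<in>F. c i = 0))"

lemma indep_modI:
  "(\<And>F c i. finite F \<Longrightarrow> F \<subseteq> I \<Longrightarrow> (\<Sum>i\<in>F. scale (c i) (f i)) \<in> U \<Longrightarrow> i \<in> F \<Longrightarrow> c i = 0) \<Longrightarrow> indep_mod U f I"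
  by (auto simp: indep_mod_def)

lemma indep_modD:
  "indep_mod U f I \<Longrightarrow> finite F \<Longrightarrow> F \<subseteq> I \<Longrightarrow> (\<Sum>i\<in>F. scale (c i) (f i)) \<in> U \<Longrightarrow> i \<in> F \<Longrightarrow> c i = 0"
  by (auto simp: indep_mod_def)

lemma indep_mod_subset: "indep_mod U f I \<Longrightarrow> J \<subseteq> I \<Longrightarrow> indep_mod U f J"
  unfolding indep_mod_def by (metis order_trans)

lemma indep_mod_reindex:
  assumes "indep_mod U f I" "finite F" "inj_on \<phi> F" "\<phi> ` F \<subseteq> I"
    "(\<Sum>i\<in>F. scale (c i) (f (\<phi> i))) \<in> U" "i \<in> F"
  shows "c i = 0"
proof -
  have "(\<Sum>j\<in>\<phi> ` F. scale (c (the_inv_into F \<phi> j)) (f j)) = (\<Sum>i\<in>F. scale (c i) (f (\<phi> i)))"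
    using assms(3) by (simp add: sum.reindex the_inv_into_f_f)
  then have "c (the_inv_into F \<phi> (\<phi> i)) = 0"
    using assms by (intro indep_modD[OF assms(1), of "\<phi> ` F" "\<lambda>j. c (the_inv_into F \<phi> j)"]) auto
  then show ?thesis using assms by (simp add: the_inv_into_f_f)
qed

text \<open>Functionals dual to a family are the tool for isolating one term of a linear relation.\<close>

lemma dual_functional:
  assumes "subspace U" "indep_mod U f I" "p \<in> I"
  obtains h where "functional h" "\<And>u. u \<in> U \<Longrightarrow> h u = 0"
    "\<And>q. q \<in> I \<Longrightarrow> h (f q) = (if q = p then 1 else 0)"
proof -
  have "f p \<notin> span (U \<union> f ` (I - {p}))"
  proof
    assume "f p \<in> span (U \<union> f ` (I - {p}))"
    then obtain u w where u: "u \<in> span U" "w \<in> span (f ` (I - {p}))" "f p = u + w"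
      unfolding span_Un mem_Collect_eq by blast
    have "u \<in> U" using u(1) assms(1) by (metis span_eq_iff)
    from span_image_as_sum[OF u(2)]
    obtain F c where F: "finite F" "F \<subseteq> I - {p}" "w = (\<Sum>i\<in>F. scale (c i) (f i))"
      by (elim exE conjE)
    let ?c = "\<lambda>i. if i = p then 1 else - c i"
    have "(\<Sum>i\<in>insert p F. scale (?c i) (f i)) = f p + (\<Sum>i\<in>F. scale (?c i) (f i))"
      using F by (subst sum.insert) auto
    also have "(\<Sum>i\<in>F. scale (?c i) (f i)) = - w"
      unfolding F(3) sum_negf[symmetric] using F(2) by (intro sum.cong) auto
    finally have "(\<Sum>i\<in>insert p F. scale (?c i) (f i)) \<in> U" using u \<open>u \<in> U\<close> by simp
    then have "?c p = 0"
      by (rule indep_modD[OF assms(2), rotated 2]) (use F assms(3) in auto)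
    then show False by simp
  qed
  then obtain h where h: "functional h" "h (f p) = 1" "\<And>x. x \<in> span (U \<union> f ` (I - {p})) \<Longrightarrow> h x = 0"
    by (rule separating_functional) blast
  show ?thesis
    by (rule that[of h]) (use h in \<open>auto intro: span_base\<close>)
qed

lemma indep_mod_card_le_dim:
  assumes "indep_mod {0} f I" "finite I" "f ` I \<subseteq> V" "finite T" "V \<subseteq> span T"
  shows "card I \<le> dim V"
proof -
  have inj: "inj_on f I"
  proof (rule inj_onI, rule ccontr)
    fix i j assume ij: "i \<in> I" "j \<in> I" "f i = f j" "i \<noteq> j"
    have "(if i = i then 1 else - 1 :: 'k) = 0"
      by (rule indep_modD[OF assms(1), of "{i, j}" "\<lambda>l. if l = i then 1 else - 1"]) (use ij in auto)
    then show False by simp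
  qed
  have "independent (f ` I)"
    unfolding dependent_finite[OF finite_imageI[OF assms(2)]]
  proof (clarsimp)
    fix u i assume "(\<Sum>v\<in>f ` I. scale (u v) v) = 0" "i \<in> I" "u (f i) \<noteq> 0"
    then show False
      using indep_modD[OF assms(1,2) order_refl, of "\<lambda>i. u (f i)" i] inj by (simp add: sum.reindex)
  qed
  obtain B where B: "B \<subseteq> V" "independent B" "V \<subseteq> span B" "card B = dim V"
    by (rule basis_exists)
  then have "finite B"
    using independent_span_bound[OF assms(4), of B] assms(5) by blast
  then have "card (f ` I) \<le> card B"
    using independent_span_bound[of B "f ` I"] \<open>independent (f ` I)\<close> B assms(3) by blast
  then show ?thesis using B inj by (simp add: card_image)
qed

text \<open>Maps that are bilinear only up to the relations of the tensor square still descend.\<close>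

lemma lin_ext_teq_mod:
  assumes "\<And>a a' b. F (a + a', b) \<doteq> F (a, b) + F (a', b)"
    and "\<And>a b b'. F (a, b + b') \<doteq> F (a, b) + F (a, b')"
    and "\<And>r a b. F (scale r a, b) \<doteq> free_scale r (F (a, b))"
    and "\<And>r a b. F (a, scale r b) \<doteq> free_scale r (F (a, b))"
    and "t \<doteq> u"
  shows "lin_ext free_scale F t \<doteq> lin_ext free_scale F u"
proof -
  have "lin_ext free_scale F (t - u) \<in> free.span (tensor_relations scale)"
  proof (rule linear_span_into[OF linear_lin_ext_free _ assms(5)[unfolded tensor_eq_def]])
    fix r assume "r \<in> tensor_relations scale"
    then show "lin_ext free_scale F r \<in> free.span (tensor_relations scale)"
      using assms(1-4) by (auto simp: tensor_relations_def lin_ext_free_simps tensor_eq_def diff_diff_add)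
  qed
  then show ?thesis by (simp add: tensor_eq_def lin_ext_free_simps)
qed

end

section \<open>Group-like and skew primitive elements\<close>

context hopf_algebra
begin

text \<open>The operator \<open>(id \<otimes> h) \<circ> \<Delta>\<close> attached to a linear functional \<open>h\<close>.\<close>

definition slice :: "('a \<Rightarrow> 'k) \<Rightarrow> 'a \<Rightarrow> 'a" where
  "slice h x = lin_ext scale (\<lambda>(a, b). scale (h b) a) (\<Delta> x)"

lemma bilinear_map_slice: "functional h \<Longrightarrow> bilinear_map scale (\<lambda>(a, b). scale (h b) a)"
  by (simp add: bilinear_map_def functional_simps scale_left_distrib scale_right_distrib mult.commute)

lemma slice_eq: "functional h \<Longrightarrow> \<Delta> x \<doteq> t \<Longrightarrow> slice h x = lin_ext scale (\<lambda>(a, b). scale (h b) a) t"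
  unfolding slice_def by (intro lin_ext_teq vector_space_axioms bilinear_map_slice)

lemma slice_add: "functional h \<Longrightarrow> slice h (x + y) = slice h x + slice h y"
  using slice_eq[OF _ comult_add] by (simp add: lin_ext_add slice_def)

lemma slice_scale: "functional h \<Longrightarrow> slice h (scale r x) = scale r (slice h x)"
  using slice_eq[OF _ comult_scale] by (simp add: lin_ext_free_scale slice_def)

lemma slice_zero: "functional h \<Longrightarrow> slice h 0 = 0"
  using slice_scale[of h 0 0] by simp

lemma slice_sum: "functional h \<Longrightarrow> slice h (sum f I) = (\<Sum>i\<in>I. slice h (f i))"
  by (induction I rule: infinite_finite_induct) (simp_all add: slice_zero slice_add)

lemma linear_slice: "functional h \<Longrightarrow> Vector_Spaces.linear scale scale (slice h)"
  by unfold_locales (simp_all add: slice_add slice_scale)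

lemma slice_fun_add: "slice (\<lambda>z. h z + h' z) x = slice h x + slice h' x"
  unfolding slice_def by (simp add: case_prod_unfold scale_left_distrib lin_ext_fun_add)

lemma slice_fun_scale: "slice (\<lambda>z. r * h z) x = scale r (slice h x)"
  unfolding slice_def by (simp add: case_prod_unfold lin_ext_fun_scale flip: scale_scale)

text \<open>A coproduct \<open>\<Delta> y = \<Sum> a \<otimes> b\<close> turns left multiplication by \<open>y\<close> into \<open>\<Sum> a (slice (h (b _)) x)\<close>.  With
  this rule, slices of products can be computed factor by factor without expanding \<open>\<Delta>\<close> on products.\<close>

lemma slice_mult:
  assumes "functional h" "\<Delta> y \<doteq> t"
  shows "slice h (y * x) = lin_ext scale (\<lambda>(a, b). a * slice (\<lambda>z. h (b * z)) x) t"
proof -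
  have lin: "Vector_Spaces.linear free_scale scale (lin_ext scale f)" for f :: "'a \<times> 'a \<Rightarrow> 'a"
    by (rule linear_lin_ext)
  have "slice h (y * x) = lin_ext scale (\<lambda>(a, b). scale (h b) a) (tensor_mult (\<Delta> y) (\<Delta> x))"
    by (intro slice_eq assms comult_mult)
  also have "\<dots> = lin_ext scale (\<lambda>(a, b). a * slice (\<lambda>z. h (b * z)) x) (\<Delta> y)"
    unfolding tensor_mult_def slice_def
    by (simp add: linear_lin_ext_comp[OF lin] linear_lin_ext_comp[OF linear_mult(1)] case_prod_unfold
        lin_ext_tens scale_mult_right)
  also have "\<dots> = lin_ext scale (\<lambda>(a, b). a * slice (\<lambda>z. h (b * z)) x) t"
    by (rule lin_ext_teq[OF vector_space_axioms _ assms(2)])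
      (simp add: bilinear_map_def distrib_left distrib_right scale_mult_left scale_mult_right
        functional_simps[OF assms(1)] slice_fun_add slice_fun_scale)
  finally show ?thesis .
qed

lemma slice_grouplike: "functional h \<Longrightarrow> g \<in> grouplikes \<Longrightarrow> slice h g = scale (h g) g"
  using slice_eq[of h g "tens g g"] by (simp add: grouplikes_def lin_ext_tens)

lemma slice_one: "functional h \<Longrightarrow> slice h 1 = scale (h 1) 1"
  using slice_eq[OF _ comult_one] by (simp add: lin_ext_tens)

lemma slice_skew: "functional h \<Longrightarrow> has_weight y g \<Longrightarrow> slice h y = scale (h 1) y + scale (h y) g"
  using slice_eq[of h y "tens y 1 + tens g y"] by (simp add: has_weight_def lin_ext_tens lin_ext_add)

lemma slice_mult_grouplike:
  "functional h \<Longrightarrow> g \<in> grouplikes \<Longrightarrow> slice h (g * x) = g * slice (\<lambda>z. h (g * z)) x"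
  using slice_mult[of h g "tens g g"] by (simp add: grouplikes_def lin_ext_tens)

lemma slice_mult_skew:
  "functional h \<Longrightarrow> has_weight y g \<Longrightarrow> slice h (y * x) = y * slice h x + g * slice (\<lambda>z. h (y * z)) x"
  using slice_mult[of h y "tens y 1 + tens g y"] by (simp add: has_weight_def lin_ext_tens lin_ext_add)

lemma one_grouplike: "1 \<in> grouplikes"
  using comult_one by (simp add: grouplikes_def)

lemma tensor_mult_tens_assoc:
  "tensor_mult (tens a b) (tensor_mult (tens c d) t) = tensor_mult (tens (a * c) (b * d)) t"
  unfolding tensor_mult_def
  by (simp add: lin_ext_free_simps linear_lin_ext_comp[OF linear_lin_ext_free] case_prod_unfold mult.assoc)

lemma tensor_mult_one: "tensor_mult (tens 1 1) t = t"
  using lin_ext_expand[of t] unfolding tensor_mult_def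
  by (simp add: lin_ext_free_simps case_prod_unfold) (simp add: tens_def)

lemma counit_functional: "functional \<epsilon>"
  using counit_linear by (simp add: functional_def)

lemma counit_grouplike: "g \<in> grouplikes \<Longrightarrow> \<epsilon> g = 1"
proof -
  assume g: "g \<in> grouplikes"
  have "scale (\<epsilon> g) g = g"
    using slice_grouplike[OF counit_functional g] counit_right[of g] by (simp add: slice_def)
  then have "scale (\<epsilon> g - 1) g = 0" by (simp add: scale_left_diff_distrib)
  then show ?thesis using g by (simp add: grouplikes_def)
qed

lemma antipode_simps: "S (x + y) = S x + S y" "S (scale r x) = scale r (S x)"
proof -
  interpret Vector_Spaces.linear scale scale S by (rule antipode_linear)
  show "S (x + y) = S x + S y" "S (scale r x) = scale r (S x)" by (rule add scale)+
qed

text \<open>The antipode axioms, evaluated on \<open>\<Delta> g = g \<otimes> g\<close>, say that \<open>S g\<close> is the inverse of \<open>g\<close>.\<close>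

lemma antipode_grouplike:
  assumes "g \<in> grouplikes"
  shows "S g * g = 1" "g * S g = 1"
proof -
  have g: "\<Delta> g \<doteq> tens g g" using assms by (simp add: grouplikes_def)
  have "lin_ext scale (\<lambda>(a, b). S a * b) (\<Delta> g) = lin_ext scale (\<lambda>(a, b). S a * b) (tens g g)"
    by (rule lin_ext_teq[OF vector_space_axioms _ g])
      (simp add: bilinear_map_def antipode_simps distrib_left distrib_right scale_mult_left scale_mult_right)
  then show "S g * g = 1" using antipode_left[of g] assms by (simp add: lin_ext_tens counit_grouplike)
  have "lin_ext scale (\<lambda>(a, b). a * S b) (\<Delta> g) = lin_ext scale (\<lambda>(a, b). a * S b) (tens g g)"
    by (rule lin_ext_teq[OF vector_space_axioms _ g])
      (simp add: bilinear_map_def antipode_simps distrib_left distrib_right scale_mult_left scale_mult_right)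
  then show "g * S g = 1" using antipode_right[of g] assms by (simp add: lin_ext_tens counit_grouplike)
qed

lemma mult_grouplike:
  assumes "g \<in> grouplikes" "g' \<in> grouplikes"
  shows "g * g' \<in> grouplikes"
proof -
  have "S g * (g * g') = g'"
    using antipode_grouplike[OF assms(1)] by (simp flip: mult.assoc)
  then have "g * g' \<noteq> 0" using assms(2) by (auto simp: grouplikes_def)
  moreover have "\<Delta> (g * g') \<doteq> tens (g * g') (g * g')"
    using teq_trans[OF comult_mult tensor_mult_cong[of "\<Delta> g" "tens g g" "\<Delta> g'" "tens g' g'"]] assms
    by (simp add: grouplikes_def tensor_mult_simps)
  ultimately show ?thesis by (simp add: grouplikes_def)
qed

lemma inverse_grouplike:
  assumes "g \<in> grouplikes"
  shows "S g \<in> grouplikes"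
proof -
  note inv = antipode_grouplike[OF assms]
  have "S g \<noteq> 0" using inv by auto
  moreover have "\<Delta> (S g) \<doteq> tens (S g) (S g)"
  proof -
    have "tensor_mult (tens g g) (\<Delta> (S g)) \<doteq> tensor_mult (\<Delta> g) (\<Delta> (S g))"
      using assms by (intro tensor_mult_cong) (auto simp: grouplikes_def intro: teq_sym)
    also have "\<dots> \<doteq> \<Delta> (g * S g)" by (rule teq_sym[OF comult_mult])
    also have "\<dots> \<doteq> tens 1 1" unfolding inv by (rule comult_one)
    finally have "tensor_mult (tens (S g) (S g)) (tensor_mult (tens g g) (\<Delta> (S g)))
        \<doteq> tensor_mult (tens (S g) (S g)) (tens 1 1)"
      by (intro tensor_mult_cong) simp_all
    then show ?thesis
      by (simp add: tensor_mult_tens_assoc inv tensor_mult_one tensor_mult_simps(1))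
  qed
  ultimately show ?thesis by (simp add: grouplikes_def)
qed

text \<open>Since \<open>slice h g = h(g) g\<close>, a slice rescales the terms of a linear relation separately, and the difference
  of a relation and a suitable slice of it is a shorter one.\<close>

lemma grouplikes_indep: "indep_mod {0} (\<lambda>g. g) grouplikes"
proof (rule indep_modI)
  fix F c g
  assume "finite F" "F \<subseteq> grouplikes" "(\<Sum>i\<in>F. scale (c i) i) \<in> {0}" "g \<in> F"
  then show "c g = 0"
  proof (induction F arbitrary: c g rule: finite_induct)
    case (insert a F)
    have a: "a \<in> grouplikes" "a \<noteq> 0" and F: "F \<subseteq> grouplikes"
      using insert.prems by (auto simp: grouplikes_def)
    have F0: "\<And>g. g \<in> F \<Longrightarrow> c g = 0" if "c a = 0"
      using insert that F by auto
    have "c a = 0"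
    proof (rule ccontr)
      assume ca: "c a \<noteq> 0"
      have sum0: "scale (c a) a + (\<Sum>i\<in>F. scale (c i) i) = 0"
        using insert by simp
      have z: "c i = 0" if i: "i \<in> F" for i
      proof -
        \<comment> \<open>With \<open>h a = 1\<close> and \<open>h i = 0\<close>, subtracting the relation from its slice removes \<open>a\<close> and keeps \<open>i\<close>.\<close>
        have "a \<notin> span {i}"
        proof
          assume "a \<in> span {i}"
          then obtain r where r: "a = scale r i" by (auto simp: span_singleton)
          have "\<epsilon> a = r * \<epsilon> i" by (simp add: r functional_simps[OF counit_functional])
          then have "a = i" using r a i F by (simp add: counit_grouplike subset_iff)
          then show False using i insert by simp
        qed
        then obtain h where h: "functional h" "h a = 1" "h i = 0"
          by (metis separating_functional span_base singletonI)
        have "scale (c a * h a) a + (\<Sum>i\<in>F. scale (c i * h i) i) = slice h (scale (c a) a + (\<Sum>i\<in>F. scale (c i) i))"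
          unfolding slice_add[OF h(1)] slice_sum[OF h(1)] slice_scale[OF h(1)]
          using a F by (intro arg_cong2[where f = "(+)"] sum.cong) (auto simp: slice_grouplike h(1))
        also have "\<dots> = 0" by (simp add: sum0 slice_zero h)
        finally have "scale (c a) a + (\<Sum>i\<in>F. scale (c i * h i) i) = 0"
          by (simp add: h)
        then have "(\<Sum>i\<in>F. scale (c i * h i) i) = (\<Sum>i\<in>F. scale (c i) i)"
          using sum0 by (metis add_left_cancel)
        then have "(\<Sum>i\<in>F. scale (c i * h i - c i) i) = 0"
          by (simp add: scale_left_diff_distrib sum_subtractf)
        then have "c i * h i - c i = 0"
          using insert.IH[OF F, of "\<lambda>i. c i * h i - c i"] i by simp
        then show ?thesis using h by simp
      qed
      then have "scale (c a) a = 0" using sum0 by simp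
      then show False using a ca by simp
    qed
    then show ?case using F0 insert.prems by auto
  qed simp
qed

lemma subspace_C0: "subspace C0" and grouplike_C0: "g \<in> grouplikes \<Longrightarrow> g \<in> C0"
  by (auto simp: C0_def span_base)

lemma one_C0: "1 \<in> C0"
  by (simp add: grouplike_C0 one_grouplike)

lemma C0_mult: "x \<in> C0 \<Longrightarrow> y \<in> C0 \<Longrightarrow> x * y \<in> C0"
proof -
  assume x: "x \<in> C0" and y: "y \<in> C0"
  have *: "g * y \<in> C0" if "g \<in> grouplikes" for g
    using y[unfolded C0_def]
  proof (induction rule: span_induct_alt)
    case (step r z w)
    then show ?case using that subspace_C0
      by (simp add: distrib_left scale_mult_right subspace_add subspace_scale grouplike_C0 mult_grouplike)
  qed (use subspace_C0 in \<open>auto intro: subspace_0\<close>)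
  show ?thesis
    using x[unfolded C0_def]
    by (induction rule: span_induct_alt)
      (use subspace_C0 * in \<open>auto simp: distrib_right scale_mult_left intro!: subspace_add subspace_scale subspace_0\<close>)
qed

lemma has_weight_unique:
  assumes "has_weight y g" "has_weight y g'" "y \<noteq> 0"
  shows "g = g'"
proof -
  obtain h where "functional h" "h y = 1"
    using separating_functional[of y "{}"] assms(3) by auto
  then show ?thesis using slice_skew[of h y g] slice_skew[of h y g'] assms by simp
qed

lemma weight_eq: "has_weight y g \<Longrightarrow> y \<noteq> 0 \<Longrightarrow> weight y = g"
  unfolding weight_def by (blast intro: the_equality has_weight_unique)

text \<open>Coassociativity forces the weight to be group-like: apply a functional with \<open>h 1 = 0\<close> and
  \<open>h y = 1\<close> to the third tensor factor of \<open>(\<Delta> \<otimes> id) (\<Delta> y) = (id \<otimes> \<Delta>) (\<Delta> y)\<close>.\<close>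

lemma weight_grouplike:
  assumes y: "has_weight y g" "y \<notin> C0"
  shows "g \<in> grouplikes"
proof -
  have "y \<noteq> 0" using y subspace_C0 subspace_0 by blast
  have "g \<noteq> 0"
  proof
    assume "g = 0"
    have "bilinear_map scale (\<lambda>(a, b). scale (\<epsilon> a) b)"
      by (simp add: bilinear_map_def functional_simps[OF counit_functional] scale_left_distrib
          scale_right_distrib mult.commute)
    from lin_ext_teq[OF vector_space_axioms this y(1)[unfolded has_weight_def]]
    have "y = scale (\<epsilon> y) 1"
      by (simp add: counit_left lin_ext_add lin_ext_tens \<open>g = 0\<close> functional_simps[OF counit_functional])
    then show False using y(2) one_C0 subspace_C0 by (metis subspace_scale)
  qed
  obtain h where h: "functional h" "h y = 1" "h 1 = 0"
    using y(2) separating_functional[of y grouplikes] one_C0 unfolding C0_def by metis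
  define T :: "('a \<times> 'a \<times> 'a \<Rightarrow>\<^sub>0 'k) \<Rightarrow> ('a \<times> 'a \<Rightarrow>\<^sub>0 'k)"
    where "T = lin_ext free_scale (\<lambda>(a, b, c). free_scale (h c) (tens a b))"
  have linT: "Vector_Spaces.linear free_scale free_scale T"
    unfolding T_def by (rule linear_lin_ext_free)
  have T3: "T (tens3 a b c) = free_scale (h c) (tens a b)" for a b c
    by (simp add: T_def lin_ext_free_simps)
  have T: "T (t + u) = T t + T u" "T (t - u) = T t - T u" "T (free_scale r t) = free_scale r (T t)" for t u r
    by (simp_all add: T_def lin_ext_free_simps)
  have T_rel: "T r \<in> free.span (tensor_relations scale)" if "r \<in> tensor3_relations scale" for r
    using that unfolding tensor3_relations_def Un_iff mem_Collect_eq
  proof (elim disjE; clarify)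
    fix a a' b c
    show "T (tens3 (a + a') b c - tens3 a b c - tens3 a' b c) \<in> free.span (tensor_relations scale)"
      using teq_scale[OF teq_tens_add_left[of a a' b], of "h c"]
      by (simp add: T T3 tensor_eq_def free.scale_right_distrib diff_diff_add)
  next
    fix a b b' c
    show "T (tens3 a (b + b') c - tens3 a b c - tens3 a b' c) \<in> free.span (tensor_relations scale)"
      using teq_scale[OF teq_tens_add_right[of a b b'], of "h c"]
      by (simp add: T T3 tensor_eq_def free.scale_right_distrib diff_diff_add)
  next
    fix r a b c
    show "T (tens3 (scale r a) b c - free_scale r (tens3 a b c)) \<in> free.span (tensor_relations scale)"
      using teq_scale[OF teq_tens_scale_left[of r a b], of "h c"]
      by (simp add: T T3 tensor_eq_def mult.commute)
  next
    fix r a b c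
    show "T (tens3 a (scale r b) c - free_scale r (tens3 a b c)) \<in> free.span (tensor_relations scale)"
      using teq_scale[OF teq_tens_scale_right[of a r b], of "h c"]
      by (simp add: T T3 tensor_eq_def mult.commute)
  qed (simp_all add: T T3 functional_simps[OF h(1)] free.scale_left_distrib free.span_zero)
  have "T (lin_ext free_scale
           (\<lambda>(a, b). lin_ext free_scale (\<lambda>(a\<^sub>1, a\<^sub>2). tens3 a\<^sub>1 a\<^sub>2 b) (\<Delta> a)) (\<Delta> y))
      \<doteq> T (lin_ext free_scale
           (\<lambda>(a, b). lin_ext free_scale (\<lambda>(b\<^sub>1, b\<^sub>2). tens3 a b\<^sub>1 b\<^sub>2) (\<Delta> b)) (\<Delta> y))"
    using linear_span_into[OF linT T_rel coassoc[of y, unfolded tensor3_eq_def]]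
    by (simp add: tensor_eq_def T)
  also have "T (lin_ext free_scale
           (\<lambda>(a, b). lin_ext free_scale (\<lambda>(a\<^sub>1, a\<^sub>2). tens3 a\<^sub>1 a\<^sub>2 b) (\<Delta> a)) (\<Delta> y))
      = lin_ext free_scale (\<lambda>(a, b). free_scale (h b) (\<Delta> a)) (\<Delta> y)"
    by (simp add: linear_lin_ext_comp[OF linT] case_prod_unfold T3 free.lin_ext_fun_scale tens_def lin_ext_expand)
  also have "T (lin_ext free_scale
           (\<lambda>(a, b). lin_ext free_scale (\<lambda>(b\<^sub>1, b\<^sub>2). tens3 a b\<^sub>1 b\<^sub>2) (\<Delta> b)) (\<Delta> y))
      = lin_ext free_scale (\<lambda>(a, b). lin_ext free_scale (\<lambda>(b\<^sub>1, b\<^sub>2). free_scale (h b\<^sub>2) (tens a b\<^sub>1)) (\<Delta> b)) (\<Delta> y)"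
    by (simp add: linear_lin_ext_comp[OF linT] case_prod_unfold T3)
  also have "\<dots> \<doteq> lin_ext free_scale (\<lambda>(a, b). tens a (slice h b)) (\<Delta> y)"
  proof -
    have tens_sum: "tens a (\<Sum>i\<in>A. x i) \<doteq> (\<Sum>i\<in>A. tens a (x i))" for a A and x :: "'a \<times> 'a \<Rightarrow> 'a"
    proof (induction A rule: infinite_finite_induct)
      case (insert i F)
      then show ?case
        using teq_trans[OF teq_tens_add_right[of a "x i" "sum x F"] teq_add[OF teq_refl insert.IH]]
        by simp
    qed (use teq_tens_scale_right[of a 0 0] in \<open>auto simp: free.scale_zero_left\<close>)
    have "lin_ext free_scale (\<lambda>(b\<^sub>1, b\<^sub>2). free_scale (h b\<^sub>2) (tens a b\<^sub>1)) t
        \<doteq> tens a (lin_ext scale (\<lambda>(b\<^sub>1, b\<^sub>2). scale (h b\<^sub>2) b\<^sub>1) t)" for a t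
      unfolding lin_ext_def
      by (rule teq_sym, rule teq_trans[OF tens_sum], rule teq_sum)
        (auto simp: case_prod_unfold intro: teq_tens_scale_right teq_trans[OF teq_tens_scale_right])
    then show ?thesis
      unfolding lin_ext_def[of _ _ "\<Delta> y"] by (intro teq_sum teq_scale) (auto simp: slice_def)
  qed
  finally have eq: "lin_ext free_scale (\<lambda>(a, b). free_scale (h b) (\<Delta> a)) (\<Delta> y)
      \<doteq> lin_ext free_scale (\<lambda>(a, b). tens a (slice h b)) (\<Delta> y)" .
  have "lin_ext free_scale (\<lambda>(a, b). free_scale (h b) (\<Delta> a)) (\<Delta> y)
      \<doteq> lin_ext free_scale (\<lambda>(a, b). free_scale (h b) (\<Delta> a)) (tens y 1 + tens g y)"
  proof (rule lin_ext_teq_mod[OF _ _ _ _ y(1)[unfolded has_weight_def]], simp_all)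
    fix a a' b r
    show "free_scale (h b) (\<Delta> (a + a')) \<doteq> free_scale (h b) (\<Delta> a) + free_scale (h b) (\<Delta> a')"
      using teq_scale[OF comult_add[of a a'], of "h b"] by (simp add: free.scale_right_distrib)
    show "free_scale (h b) (\<Delta> (scale r a)) \<doteq> free_scale (r * h b) (\<Delta> a)"
      using teq_scale[OF comult_scale[of r a], of "h b"] by (simp add: mult.commute)
  qed (simp_all add: functional_simps[OF h(1)] free.scale_left_distrib)
  then have L: "\<Delta> g \<doteq> lin_ext free_scale (\<lambda>(a, b). free_scale (h b) (\<Delta> a)) (\<Delta> y)"
    by (simp add: lin_ext_free_simps h teq_sym)
  have "lin_ext free_scale (\<lambda>(a, b). tens a (slice h b)) (\<Delta> y)
      \<doteq> lin_ext free_scale (\<lambda>(a, b). tens a (slice h b)) (tens y 1 + tens g y)"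
    by (rule lin_ext_teq_mod[OF _ _ _ _ y(1)[unfolded has_weight_def]])
      (simp_all add: slice_add slice_scale h teq_tens_add_left teq_tens_add_right teq_tens_scale_left teq_tens_scale_right)
  also have "\<dots> = tens y 0 + tens g g"
    using y(1) by (simp add: lin_ext_free_simps slice_one slice_skew h)
  also have "\<dots> \<doteq> tens g g"
    using teq_add[OF teq_tens_scale_right[of y 0 0] teq_refl[of "tens g g"]] by simp
  finally have "\<Delta> g \<doteq> tens g g" using L eq teq_trans by blast
  with \<open>g \<noteq> 0\<close> show ?thesis by (simp add: grouplikes_def)
qed

end

section \<open>Powers of skew primitive elements at roots of unity\<close>

definition qint :: "'k::field \<Rightarrow> nat \<Rightarrow> 'k" where
  "qint q n = (\<Sum>j<n. q ^ j)"

lemma qint_simps: "qint q 0 = 0" "qint q (Suc n) = q ^ n + qint q n"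
  by (simp_all add: qint_def)

lemma qint_rec: "qint q (Suc n) = 1 + q * qint q n"
  by (simp add: qint_def sum.lessThan_Suc_shift sum_distrib_left del: sum.lessThan_Suc)

lemma qint_telescope: "(1 - q) * qint q n = 1 - q ^ n"
proof (induction n)
  case (Suc n)
  then show ?case by (simp add: qint_simps distrib_left) (simp add: algebra_simps)
qed (simp add: qint_simps)

fun qbinom :: "'k::field \<Rightarrow> nat \<Rightarrow> nat \<Rightarrow> 'k" where
  "qbinom q n 0 = 1"
| "qbinom q 0 (Suc k) = 0"
| "qbinom q (Suc n) (Suc k) = q ^ Suc k * qbinom q n (Suc k) + qbinom q n k"

lemma qbinom_eq_0: "n < k \<Longrightarrow> qbinom q n k = 0"
  by (induction q n k rule: qbinom.induct) auto

lemma qbinom_self: "qbinom q n n = 1"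
  by (induction n) (auto simp: qbinom_eq_0)

text \<open>The absorption identity shows that \<open>qbinom q n i\<close> vanishes for \<open>0 < i < n\<close> as soon as \<open>qint q n\<close> does and
  the smaller \<open>q\<close>-integers do not.\<close>

lemma qbinom_absorb: "qint q (Suc k) * qbinom q (Suc n) (Suc k) = qint q (Suc n) * qbinom q n k"
proof (induction n arbitrary: k)
  case 0
  show ?case by (cases k) (simp_all add: qint_def)
next
  case (Suc n)
  show ?case
  proof (cases k)
    case 0
    show ?thesis using Suc.IH[of 0]
      by (simp add: 0 qint_rec[of q "Suc n"] qint_simps(1) qint_simps(2)[of q 0] add.commute)
  next
    case (Suc j)
    define B where "B = qbinom q (Suc n) (Suc j)"
    define B1 where "B1 = qbinom q n (Suc j)"
    define B2 where "B2 = qbinom q n j"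
    have rec: "B = q ^ Suc j * B1 + B2" by (simp add: B_def B1_def B2_def)
    have IH1: "qint q (Suc (Suc j)) * qbinom q (Suc n) (Suc (Suc j)) = qint q (Suc n) * B1"
      using Suc.IH[of "Suc j"] by (simp add: B1_def)
    have IH2: "qint q (Suc j) * B = qint q (Suc n) * B2"
      using Suc.IH[of j] by (simp add: B_def B2_def)
    have tel: "q ^ Suc j = 1 - (1 - q) * qint q (Suc j)"
      using qint_telescope[of q "Suc j"] by (simp add: algebra_simps)
    have "qbinom q (Suc (Suc n)) (Suc (Suc j)) = q ^ Suc (Suc j) * qbinom q (Suc n) (Suc (Suc j)) + B"
      unfolding B_def by (rule qbinom.simps)
    then have "qint q (Suc (Suc j)) * qbinom q (Suc (Suc n)) (Suc (Suc j))
        = q ^ Suc (Suc j) * (qint q (Suc (Suc j)) * qbinom q (Suc n) (Suc (Suc j)))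
          + qint q (Suc (Suc j)) * B"
      by (simp only: distrib_left mult.left_commute)
    also have "\<dots> = q * (q ^ Suc j * (qint q (Suc n) * B1)) + (q ^ Suc j + qint q (Suc j)) * B"
      unfolding IH1 by (simp only: qint_simps(2)[of q "Suc j"] power_Suc[of q "Suc j"] mult.assoc)
    also have "q ^ Suc j * (qint q (Suc n) * B1) = qint q (Suc n) * (B - B2)"
      using rec by (simp add: algebra_simps)
    also have "\<dots> = qint q (Suc n) * B - qint q (Suc j) * B"
      by (simp only: right_diff_distrib IH2)
    also have "q * (qint q (Suc n) * B - qint q (Suc j) * B) + (q ^ Suc j + qint q (Suc j)) * B
        = (1 + q * qint q (Suc n)) * B"
      unfolding tel by (simp add: algebra_simps)
    also have "1 + q * qint q (Suc n) = qint q (Suc (Suc n))" by (rule qint_rec[symmetric])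
    finally show ?thesis by (simp only: Suc B_def)
  qed
qed

context hopf_algebra
begin

lemma qcommute_power:
  assumes "y * g = scale q (g * y)"
  shows "y * g ^ i = scale (q ^ i) (g ^ i * y)"
proof (induction i)
  case (Suc i)
  have "y * g ^ Suc i = scale q (g * (y * g ^ i))"
    using assms by (simp add: scale_mult_left flip: mult.assoc)
  then show ?case by (simp add: Suc.IH scale_mult_right mult.assoc)
qed simp

text \<open>The \<open>q\<close>-binomial theorem for \<open>\<Delta> y = y \<otimes> 1 + g \<otimes> y\<close>, whose two summands \<open>q\<close>-commute.\<close>

lemma comult_skew_power:
  assumes y: "has_weight y g" and comm: "y * g = scale q (g * y)"
  shows "\<Delta> (y ^ n) \<doteq> (\<Sum>i\<le>n. free_scale (qbinom q n i) (tens (g ^ i * y ^ (n - i)) (y ^ i)))"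
proof (induction n)
  case 0
  show ?case using comult_one by simp
next
  case (Suc n)
  let ?T = "\<lambda>i. tens (g ^ i * y ^ (Suc n - i)) (y ^ i)"
  have sum: "tensor_mult t (sum f A) = (\<Sum>i\<in>A. tensor_mult t (f i))"
    for t :: "'a \<times> 'a \<Rightarrow>\<^sub>0 'k" and f and A :: "nat set"
    using tensor_mult_simps(7)[of t 0 0]
    by (induction A rule: infinite_finite_induct) (simp_all add: tensor_mult_simps)
  have "\<Delta> (y ^ Suc n) \<doteq> tensor_mult (\<Delta> y) (\<Delta> (y ^ n))"
    using comult_mult by simp
  also have "\<dots> \<doteq> tensor_mult (tens y 1 + tens g y)
      (\<Sum>i\<le>n. free_scale (qbinom q n i) (tens (g ^ i * y ^ (n - i)) (y ^ i)))"
    using y Suc.IH by (intro tensor_mult_cong) (simp_all add: has_weight_def)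
  also have "\<dots> = (\<Sum>i\<le>n. free_scale (qbinom q n i) (tens (y * g ^ i * y ^ (n - i)) (y ^ i)))
      + (\<Sum>i\<le>n. free_scale (qbinom q n i) (?T (Suc i)))"
    by (simp add: tensor_mult_simps sum mult.assoc free.scale_right_distrib sum.distrib)
  also have "\<dots> \<doteq> (\<Sum>i\<le>n. free_scale (q ^ i * qbinom q n i) (?T i))
      + (\<Sum>i\<le>n. free_scale (qbinom q n i) (?T (Suc i)))"
  proof (intro teq_add teq_sum teq_refl)
    fix i assume "i \<in> {..n}"
    then have "y * g ^ i * y ^ (n - i) = scale (q ^ i) (g ^ i * y ^ (Suc n - i))"
      by (simp add: qcommute_power[OF comm] scale_mult_left mult.assoc Suc_diff_le)
    then show "free_scale (qbinom q n i) (tens (y * g ^ i * y ^ (n - i)) (y ^ i))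
        \<doteq> free_scale (q ^ i * qbinom q n i) (?T i)"
      using teq_scale[OF teq_tens_scale_left, of "qbinom q n i"] by (simp add: mult.commute)
  qed
  also have "(\<Sum>i\<le>n. free_scale (q ^ i * qbinom q n i) (?T i))
      = free_scale 1 (?T 0) + (\<Sum>i\<le>n. free_scale (q ^ Suc i * qbinom q n (Suc i)) (?T (Suc i)))"
  proof -
    have "(\<Sum>i\<le>n. free_scale (q ^ i * qbinom q n i) (?T i))
        = (\<Sum>i\<le>Suc n. free_scale (q ^ i * qbinom q n i) (?T i))"
      by (simp add: qbinom_eq_0)
    then show ?thesis by (simp only: sum.atMost_Suc_shift power_0 qbinom.simps mult_1)
  qed
  also have "free_scale 1 (?T 0) + (\<Sum>i\<le>n. free_scale (q ^ Suc i * qbinom q n (Suc i)) (?T (Suc i)))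
      + (\<Sum>i\<le>n. free_scale (qbinom q n i) (?T (Suc i)))
      = (\<Sum>i\<le>Suc n. free_scale (qbinom q (Suc n) i) (?T i))"
    unfolding sum.atMost_Suc_shift qbinom.simps free.scale_left_distrib sum.distrib
    by (simp only: add.assoc)
  finally show ?case .
qed

lemma has_weight_power_root_of_unity:
  assumes "has_weight y g" "y * g = scale q (g * y)" "n > 1" "q ^ n = 1"
    and prim: "\<And>j. 0 < j \<Longrightarrow> j < n \<Longrightarrow> q ^ j \<noteq> 1"
  shows "has_weight (y ^ n) (g ^ n)"
proof -
  have "q \<noteq> 1" using prim[of 1] assms(3) by auto
  have zero: "qbinom q n i = 0" if i: "0 < i" "i < n" for i
  proof -
    obtain k m where km: "i = Suc k" "n = Suc m" using i by (metis gr0_conv_Suc less_trans)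
    have "qint q n = 0" "qint q i \<noteq> 0"
      using qint_telescope[of q n] qint_telescope[of q i] \<open>q \<noteq> 1\<close> assms(4) prim[OF i] by auto
    then show ?thesis using qbinom_absorb[of q k m] km by simp
  qed
  have "(\<Sum>i\<le>n. free_scale (qbinom q n i) (tens (g ^ i * y ^ (n - i)) (y ^ i)))
      = (\<Sum>i\<in>{0, n}. free_scale (qbinom q n i) (tens (g ^ i * y ^ (n - i)) (y ^ i)))"
    using zero by (intro sum.mono_neutral_right) auto
  also have "\<dots> = tens (y ^ n) 1 + tens (g ^ n) (y ^ n)"
    using assms(3) by (simp add: qbinom_self)
  finally show ?thesis
    using comult_skew_power[OF assms(1,2), of n] by (simp add: has_weight_def)
qed

end

section \<open>The filtration by the number of skew primitive factors\<close>

context hopf_algebra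
begin

inductive skew_word :: "'a \<Rightarrow> nat \<Rightarrow> bool" where
  one: "skew_word 1 0"
| grouplike: "g \<in> grouplikes \<Longrightarrow> skew_word x n \<Longrightarrow> skew_word (g * x) n"
| skew: "has_weight y g \<Longrightarrow> g \<in> grouplikes \<Longrightarrow> skew_word x n \<Longrightarrow> skew_word (y * x) (Suc n)"

text \<open>The inequality is strict so that \<open>Fil 0 = 0\<close> and \<open>Fil 1 = C0\<close>; thus \<open>Fil n\<close> is what is discarded when
  products with \<open>n\<close> skew primitive factors are compared.\<close>

definition Fil :: "nat \<Rightarrow> 'a set" where
  "Fil n = span {x. \<exists>m<n. skew_word x m}"

lemma subspace_Fil: "subspace (Fil n)"
  by (simp add: Fil_def)

lemma Fil_0: "Fil 0 = {0}"
  by (simp add: Fil_def)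

lemma Fil_zero: "0 \<in> Fil n"
  by (simp add: subspace_0 subspace_Fil)

lemma Fil_mono: "m \<le> n \<Longrightarrow> Fil m \<subseteq> Fil n"
  unfolding Fil_def by (intro span_mono) (blast intro: less_le_trans)

lemma Fil_word: "skew_word x m \<Longrightarrow> m < n \<Longrightarrow> x \<in> Fil n"
  unfolding Fil_def by (intro span_base) auto

lemma Fil_closed:
  "x \<in> Fil n \<Longrightarrow> y \<in> Fil n \<Longrightarrow> x + y \<in> Fil n" "x \<in> Fil n \<Longrightarrow> y \<in> Fil n \<Longrightarrow> x - y \<in> Fil n"
  "x \<in> Fil n \<Longrightarrow> scale r x \<in> Fil n" "(\<And>i. i \<in> A \<Longrightarrow> f i \<in> Fil n) \<Longrightarrow> sum f A \<in> Fil n"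
  by (simp_all add: subspace_Fil subspace_add subspace_diff subspace_scale subspace_sum)

lemma Fil_induct:
  assumes "x \<in> Fil n" "subspace U" "Vector_Spaces.linear scale scale L"
    "\<And>z m. skew_word z m \<Longrightarrow> m < n \<Longrightarrow> L z \<in> U"
  shows "L x \<in> U"
proof -
  have "L x \<in> span U"
    using assms(3) _ assms(1)[unfolded Fil_def]
    by (rule linear_span_into) (use assms(4) in \<open>auto intro: span_base\<close>)
  then show ?thesis using assms(2) by (metis span_eq_iff)
qed

lemma Fil_mult_grouplike: "g \<in> grouplikes \<Longrightarrow> x \<in> Fil n \<Longrightarrow> g * x \<in> Fil n"
  by (erule Fil_induct[OF _ subspace_Fil linear_mult(1)]) (blast intro: Fil_word grouplike)

lemma Fil_mult_skew: "has_weight y g \<Longrightarrow> g \<in> grouplikes \<Longrightarrow> x \<in> Fil n \<Longrightarrow> y * x \<in> Fil (Suc n)"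
  by (erule Fil_induct[OF _ subspace_Fil linear_mult(1)]) (blast intro: Fil_word[of _ "Suc _"] skew)

lemma Fil_mult_C0: "u \<in> C0 \<Longrightarrow> x \<in> Fil n \<Longrightarrow> u * x \<in> Fil n"
  using linear_span_into[OF linear_mult(2)[of x], of grouplikes "Fil n" u] Fil_mult_grouplike[of _ x n]
  by (auto simp: C0_def span_base subspace_Fil span_eq_iff[THEN iffD2])

lemma Fil_1: "Fil 1 = C0"
proof -
  have "x \<in> grouplikes" if "skew_word x m" "m = 0" for x m
    using that by (induction) (auto intro: one_grouplike mult_grouplike)
  moreover have "skew_word x 0" if "x \<in> grouplikes" for x
    using grouplike[OF that one] by simp
  ultimately have "{x. \<exists>m<1. skew_word x m} = grouplikes" by auto
  then show ?thesis by (simp add: Fil_def C0_def)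
qed

definition vanishing :: "('a \<Rightarrow> 'k) \<Rightarrow> bool" where
  "vanishing h \<longleftrightarrow> functional h \<and> (\<forall>u\<in>C0. h u = 0)"

lemma vanishing_mult_grouplike: "vanishing h \<Longrightarrow> g \<in> grouplikes \<Longrightarrow> vanishing (\<lambda>z. h (g * z))"
  by (auto simp: vanishing_def functional_mult_left C0_mult grouplike_C0)

lemma slice_word: "skew_word x m \<Longrightarrow> functional h \<Longrightarrow> slice h x \<in> Fil (Suc m)"
proof (induction arbitrary: h rule: skew_word.induct)
  case one
  then show ?case by (auto simp: slice_one intro!: Fil_closed Fil_word[of _ 0] skew_word.one)
next
  case (grouplike g x n)
  then show ?case by (simp add: slice_mult_grouplike Fil_mult_grouplike functional_mult_left)
next
  case (skew y g x n)
  have "slice (\<lambda>z. h (y * z)) x \<in> Fil (Suc (Suc n))"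
    using skew.IH[OF functional_mult_left[OF skew.prems]] Fil_mono[of "Suc n" "Suc (Suc n)"] by auto
  then have "g * slice (\<lambda>z. h (y * z)) x \<in> Fil (Suc (Suc n))"
    by (rule Fil_mult_grouplike[OF skew.hyps(2)])
  then show ?case
    unfolding slice_mult_skew[OF skew.prems skew.hyps(1)]
    by (intro Fil_closed Fil_mult_skew[OF skew.hyps(1,2)] skew.IH skew.prems)
qed

text \<open>For functionals vanishing on \<open>C0\<close> a slice loses one degree: every term in which the last tensor factor
  contains no skew primitive is killed.\<close>

lemma slice_word_vanishing: "skew_word x m \<Longrightarrow> vanishing h \<Longrightarrow> slice h x \<in> Fil m"
proof (induction arbitrary: h rule: skew_word.induct)
  case one
  then show ?case by (auto simp: slice_one Fil_0 vanishing_def one_C0)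
next
  case (grouplike g x n)
  then show ?case
    using Fil_mult_grouplike vanishing_mult_grouplike by (simp add: slice_mult_grouplike vanishing_def[of h])
next
  case (skew y g x n)
  have h: "functional h" using skew by (simp add: vanishing_def)
  have "g * slice (\<lambda>z. h (y * z)) x \<in> Fil (Suc n)"
    by (intro Fil_mult_grouplike skew slice_word functional_mult_left h)
  then show ?case
    unfolding slice_mult_skew[OF h skew.hyps(1)]
    by (intro Fil_closed Fil_mult_skew[OF skew.hyps(1,2)] skew.IH skew.prems)
qed

lemma slice_Fil_vanishing: "x \<in> Fil (Suc n) \<Longrightarrow> vanishing h \<Longrightarrow> slice h x \<in> Fil n"
proof (erule Fil_induct[OF _ subspace_Fil linear_slice])
  fix z m assume "vanishing h" "skew_word z m" "m < Suc n"
  then show "slice h z \<in> Fil n" using slice_word_vanishing Fil_mono[of m n] by auto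
qed (simp add: vanishing_def)

end

section \<open>Independence of ordered monomials\<close>

text \<open>Words are lists of indices into a family \<open>y\<close> of skew primitives.  A slice deletes a letter \<open>i\<close> and puts
  \<open>g\<^sub>i\<close> in its place.  Moving \<open>g\<^sub>i\<close> to the front past a letter \<open>x\<close> shifts that letter to \<open>x + s\<close> and
  contributes a factor \<open>q x i\<close>; the resulting word and the total coefficient, summed over all
  occurrences of \<open>i\<close>, are \<open>del_shift\<close> and \<open>del_coeff\<close>.\<close>

fun del_shift :: "nat \<Rightarrow> nat \<Rightarrow> nat list \<Rightarrow> nat list" where
  "del_shift s i [] = []"
| "del_shift s i (x # w) = (if x = i then w else (x + s) # del_shift s i w)"

fun del_coeff :: "(nat \<Rightarrow> nat \<Rightarrow> 'k::field) \<Rightarrow> nat \<Rightarrow> nat list \<Rightarrow> 'k" where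
  "del_coeff q i [] = 0"
| "del_coeff q i (x # w) = (if x = i then 1 else 0) + q x i * del_coeff q i w"

lemma del_coeff_notin: "i \<notin> set w \<Longrightarrow> del_coeff q i w = 0"
  by (induction w) auto

lemma length_del_shift: "i \<in> set w \<Longrightarrow> length (del_shift s i w) = length w - 1"
proof (induction w)
  case (Cons a w)
  then show ?case using length_pos_if_in_set[of i w] by auto
qed simp

lemma del_shift_0: "del_shift 0 i w = remove1 i w"
  by (induction w) auto

text \<open>Repeated letters are allowed when nothing is shifted; for \<open>s = 1\<close> the words are
  strictly increasing, so that deletions stay ordered and determine the original word.\<close>

definition ordered_words :: "nat \<Rightarrow> nat set \<Rightarrow> nat list set" where
  "ordered_words s I = {w. sorted w \<and> (s = 0 \<or> distinct w) \<and> set w \<subseteq> I}"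

lemma set_del_shift_1:
  assumes "sorted w" "distinct w" "i \<in> set w" "x \<in> set (del_shift 1 i w)"
  shows "Suc (hd w) \<le> x"
  using assms
proof (induction w)
  case (Cons a w)
  show ?case
  proof (cases "a = i")
    case True
    then show ?thesis using Cons.prems by (auto simp: Suc_le_eq nat_less_le)
  next
    case False
    then have i: "i \<in> set w" using Cons.prems by simp
    then have "a \<le> hd w" using Cons.prems by (cases w) auto
    then show ?thesis using Cons False i by fastforce
  qed
qed simp

lemma del_shift_1_ordered:
  "sorted w \<Longrightarrow> distinct w \<Longrightarrow> i \<in> set w \<Longrightarrow> sorted (del_shift 1 i w) \<and> distinct (del_shift 1 i w)"
proof (induction w)
  case (Cons a w)
  show ?case
  proof (cases "a = i")
    case False
    then have i: "i \<in> set w" using Cons.prems by simp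
    then have "a < hd w" using Cons.prems by (cases w) (auto simp: nat_less_le)
    then have "Suc a < x" if "x \<in> set (del_shift 1 i w)" for x
      using set_del_shift_1[of w i x] Cons.prems that i by auto
    then show ?thesis using Cons False i by fastforce
  qed (use Cons in auto)
qed simp

text \<open>The deleted letter and its place can be recovered: the shifted letters are exactly those that are
  at most \<open>i\<close>.\<close>

lemma del_shift_1_inj:
  assumes "sorted w" "distinct w" "i \<in> set w" "sorted w'" "distinct w'" "i \<in> set w'"
    "del_shift 1 i w = del_shift 1 i w'"
  shows "w = w'"
  using assms
proof (induction w arbitrary: w')
  case (Cons a w)
  obtain a' v where w': "w' = a' # v" using Cons.prems by (cases w') auto
  consider "a = i" "a' = i" | "a = i" "a' \<noteq> i" | "a \<noteq> i" "a' = i" | "a \<noteq> i" "a' \<noteq> i" by blast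
  then show ?case
  proof cases
    case 2
    then have "w = Suc a' # del_shift 1 i v" "i \<in> set v" using Cons.prems w' by auto
    moreover from this have "a' \<le> i" using Cons.prems w' by auto
    ultimately show ?thesis using Cons.prems 2 by auto
  next
    case 3
    then have "v = Suc a # del_shift 1 i w" "i \<in> set w" using Cons.prems w' by auto
    moreover from this have "a \<le> i" using Cons.prems by auto
    ultimately show ?thesis using Cons.prems 3 w' by auto
  qed (use Cons w' in auto)
qed simp

lemma del_shift_ordered:
  assumes "w \<in> ordered_words s I" "i \<in> set w" "s \<le> 1" "s = 0 \<or> I = UNIV"
  shows "del_shift s i w \<in> ordered_words s I"
proof (cases "s = 0")
  case True
  then show ?thesis using assms
    by (auto simp: ordered_words_def del_shift_0 sorted_remove1 dest: notin_set_remove1[THEN contrapos_pp])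
next
  case False
  then have "s = 1" using assms by simp
  then show ?thesis using assms del_shift_1_ordered[of w i] by (auto simp: ordered_words_def)
qed

lemma del_shift_inj:
  assumes "w \<in> ordered_words s I" "w' \<in> ordered_words s I" "i \<in> set w" "i \<in> set w'" "s \<le> 1"
    "del_shift s i w = del_shift s i w'"
  shows "w = w'"
proof (cases "s = 0")
  case True
  then have "insort i (remove1 i w) = insort i (remove1 i w')" using assms by (simp add: del_shift_0)
  then show ?thesis using assms by (simp add: ordered_words_def insort_remove1)
next
  case False
  then have "s = 1" using assms by simp
  then show ?thesis using assms del_shift_1_inj[of w i w'] by (auto simp: ordered_words_def)
qed

text \<open>Two kinds of families are covered: finitely many eigenvectors of distinct weights (\<open>s = 0\<close>), and the
  orbit of one skew primitive under conjugation by a group-like \<open>u\<close>.  For such an orbit, all weights are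
  the same \<open>g\<close>; conjugation by \<open>g\<close> moves each member to the next one if \<open>u = g\<close> (\<open>s = 1\<close>) and is scalar
  modulo \<open>C0\<close> if the orbit starts at an eigenvector for \<open>g\<close> (\<open>s = 0\<close>).\<close>

locale skew_family = hopf_algebra scale \<Delta> \<epsilon> S
  for scale :: "'k::field \<Rightarrow> 'a::ring_1 \<Rightarrow> 'a" and \<Delta> \<epsilon> S +
  fixes y g :: "nat \<Rightarrow> 'a" and q :: "nat \<Rightarrow> nat \<Rightarrow> 'k" and s :: nat and I :: "nat set"
  assumes weight_y: "i \<in> I \<Longrightarrow> has_weight (y i) (g i)"
    and g_grouplike: "i \<in> I \<Longrightarrow> g i \<in> grouplikes"
    and commute_mod: "i \<in> I \<Longrightarrow> x \<in> I \<Longrightarrow> y x * g i - scale (q x i) (g i * y (x + s)) \<in> C0"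
    and shift: "s \<le> 1" "s = 0 \<or> I = UNIV"
    and base_indep: "indep_mod C0 (\<lambda>(u, i). u * y i) (grouplikes \<times> I)"
    and coeff_nonzero: "w \<in> ordered_words s I \<Longrightarrow> i \<in> set w \<Longrightarrow> del_coeff q i w \<noteq> 0"
begin

definition monomial :: "nat list \<Rightarrow> 'a" where
  "monomial w = prod_list (map y w)"

lemma monomial_simps [simp]: "monomial [] = 1" "monomial (i # w) = y i * monomial w"
  by (simp_all add: monomial_def)

lemma monomial_word: "set w \<subseteq> I \<Longrightarrow> skew_word (monomial w) (length w)"
  by (induction w) (auto intro: one skew weight_y g_grouplike)

text \<open>For an arbitrary functional, only the term \<open>monomial w \<otimes> 1\<close> of the coproduct matters modulo lower degree:
  choosing \<open>g\<^sub>i \<otimes> y\<^sub>i\<close> for some letter costs a skew primitive factor on the left.\<close>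

lemma slice_monomial_top:
  "set w \<subseteq> I \<Longrightarrow> functional h \<Longrightarrow> slice h (monomial w) - scale (h 1) (monomial w) \<in> Fil (length w)"
proof (induction w)
  case Nil
  then show ?case by (simp add: slice_one Fil_zero)
next
  case (Cons i w)
  then have i: "has_weight (y i) (g i)" "g i \<in> grouplikes" by (auto intro: weight_y g_grouplike)
  have "slice h (monomial (i # w)) - scale (h 1) (monomial (i # w))
      = y i * (slice h (monomial w) - scale (h 1) (monomial w)) + g i * slice (\<lambda>z. h (y i * z)) (monomial w)"
    using Cons i by (simp add: slice_mult_skew right_diff_distrib scale_mult_right)
  moreover have "y i * (slice h (monomial w) - scale (h 1) (monomial w)) \<in> Fil (Suc (length w))"
    using Cons i by (intro Fil_mult_skew) auto
  moreover have "g i * slice (\<lambda>z. h (y i * z)) (monomial w) \<in> Fil (Suc (length w))"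
    using Cons i by (intro Fil_mult_grouplike slice_word monomial_word functional_mult_left) auto
  ultimately show ?case by (simp add: Fil_closed)
qed

text \<open>Splitting off the first letter \<open>x\<close>, either the slice takes \<open>x\<close> itself, with leading term
  \<open>g\<^sub>x\<close> times the rest, or it takes a later letter \<open>i\<close>, and then \<open>g\<^sub>i\<close> has to be moved past \<open>y\<^sub>x\<close>.\<close>

lemma slice_monomial:
  assumes "w \<in> ordered_words s I" "vanishing h"
  shows "slice h (monomial w) - (\<Sum>i\<in>set w. scale (h (y i) * del_coeff q i w) (g i * monomial (del_shift s i w)))
    \<in> Fil (length w - 1)"
  using assms(1)
proof (induction w)
  case Nil
  have "functional h" "h 1 = 0" using assms(2) by (auto simp: vanishing_def one_C0)
  then show ?case by (simp add: slice_one Fil_zero)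
next
  case (Cons x w)
  have h: "functional h" using assms(2) by (auto simp: vanishing_def)
  have w: "w \<in> ordered_words s I" and wI: "set w \<subseteq> I" and x: "x \<in> I"
    using Cons.prems by (auto simp: ordered_words_def)
  have yx: "has_weight (y x) (g x)" "g x \<in> grouplikes" using x by (auto intro: weight_y g_grouplike)
  define c where "c i = h (y i) * del_coeff q i w" for i
  define E where "E = slice h (monomial w) - (\<Sum>i\<in>set w. scale (c i) (g i * monomial (del_shift s i w)))"
  define R where "R = slice (\<lambda>z. h (y x * z)) (monomial w) - scale (h (y x)) (monomial w)"
  define N where "N i = y x * g i - scale (q x i) (g i * y (x + s))" for i
  have E: "y x * E \<in> Fil (length w)"
  proof (cases w)
    case Nil
    then have "E = 0" using Cons.IH w by (simp add: E_def Fil_0)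
    then show ?thesis by (simp add: Fil_zero)
  next
    case (Cons a v)
    then show ?thesis using Fil_mult_skew[OF yx, of E "length w - 1"] Cons.IH[OF w]
      by (simp add: E_def c_def)
  qed
  have R: "g x * R \<in> Fil (length w)"
    using slice_monomial_top[OF wI functional_mult_left[OF h], of "y x"] yx(2)
    by (intro Fil_mult_grouplike) (simp_all add: R_def)
  have N: "(\<Sum>i\<in>set w. scale (c i) (N i * monomial (del_shift s i w))) \<in> Fil (length w)"
  proof (intro Fil_closed Fil_mult_C0)
    fix i assume i: "i \<in> set w"
    then show "N i \<in> C0" unfolding N_def using x wI by (intro commute_mod) auto
    have "set (del_shift s i w) \<subseteq> I"
      using del_shift_ordered[OF w i shift] by (simp add: ordered_words_def)
    then show "monomial (del_shift s i w) \<in> Fil (length w)"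
      using monomial_word[of "del_shift s i w"] length_del_shift[OF i, of s] length_pos_if_in_set[OF i]
      by (intro Fil_word) auto
  qed
  have main: "(\<Sum>i\<in>set (x # w). scale (h (y i) * del_coeff q i (x # w)) (g i * monomial (del_shift s i (x # w))))
      = (\<Sum>i\<in>set w. scale (c i * q x i) (g i * monomial ((x + s) # del_shift s i w))) + scale (h (y x)) (g x * monomial w)"
    (is "?L = ?R")
  proof -
    let ?f = "\<lambda>i. scale (c i * q x i) (g i * monomial ((x + s) # del_shift s i w))"
    let ?d = "\<lambda>i. if i = x then scale (h (y x)) (g x * monomial w) else 0"
    have xx: "monomial ((x + s) # del_shift s x w) = monomial w" if "x \<in> set w"
    proof -
      have "s = 0" using Cons.prems that by (auto simp: ordered_words_def)
      moreover obtain a v where w': "w = a # v" using \<open>x \<in> set w\<close> by (cases w) auto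
      moreover have "a = x"
        using \<open>x \<in> set w\<close> Cons.prems unfolding w' ordered_words_def by fastforce
      ultimately show ?thesis by simp
    qed
    have "?L = (\<Sum>i\<in>set (x # w). ?f i + ?d i)"
    proof (rule sum.cong)
      fix i assume i: "i \<in> set (x # w)"
      show "scale (h (y i) * del_coeff q i (x # w)) (g i * monomial (del_shift s i (x # w))) = ?f i + ?d i"
      proof (cases "i = x")
        case True
        then show ?thesis using xx
          by (cases "x \<in> set w")
            (auto simp: c_def del_coeff_notin distrib_left scale_left_distrib mult.commute mult.left_commute)
      qed (simp add: c_def mult.commute mult.left_commute)
    qed simp
    also have "\<dots> = (\<Sum>i\<in>set (x # w). ?f i) + (\<Sum>i\<in>set (x # w). ?d i)" by (rule sum.distrib)
    also have "(\<Sum>i\<in>set (x # w). ?f i) = (\<Sum>i\<in>set w. ?f i)"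
      by (rule sum.mono_neutral_right) (auto simp: c_def del_coeff_notin)
    also have "(\<Sum>i\<in>set (x # w). ?d i) = scale (h (y x)) (g x * monomial w)"
      by (simp only: sum.delta[OF finite_set]) simp
    finally show ?thesis .
  qed
  have "slice h (monomial (x # w)) = y x * slice h (monomial w) + g x * slice (\<lambda>z. h (y x * z)) (monomial w)"
    using slice_mult_skew[OF h yx(1)] by simp
  also have "y x * slice h (monomial w)
      = y x * E + (\<Sum>i\<in>set w. scale (c i) (y x * g i * monomial (del_shift s i w)))"
    by (simp add: E_def right_diff_distrib sum_distrib_left scale_mult_right mult.assoc)
  also have "(\<Sum>i\<in>set w. scale (c i) (y x * g i * monomial (del_shift s i w)))
      = (\<Sum>i\<in>set w. scale (c i) (N i * monomial (del_shift s i w)))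
        + (\<Sum>i\<in>set w. scale (c i * q x i) (g i * monomial ((x + s) # del_shift s i w)))"
    unfolding sum.distrib[symmetric]
    by (intro sum.cong refl)
      (simp add: N_def left_diff_distrib scale_mult_left scale_right_diff_distrib mult.assoc)
  also have "g x * slice (\<lambda>z. h (y x * z)) (monomial w) = g x * R + scale (h (y x)) (g x * monomial w)"
    by (simp add: R_def right_diff_distrib scale_mult_right)
  finally have "slice h (monomial (x # w)) - (\<Sum>i\<in>set (x # w). scale (h (y i) * del_coeff q i (x # w)) (g i * monomial (del_shift s i (x # w))))
     = y x * E + (\<Sum>i\<in>set w. scale (c i) (N i * monomial (del_shift s i w))) + g x * R"
    unfolding main by (simp only: algebra_simps)
  then show ?case using E N R by (simp add: Fil_closed)
qed

text \<open>
  Slicing a relation in degree \<open>n + 1\<close> with the functional dual to \<open>u\<^sub>0 y\<^sub>i\<close> leaves, in degree \<open>n\<close>, only the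
  terms with group-like factor \<open>u\<^sub>0\<close> whose word contains the letter \<open>i\<close>.  Deleting \<open>i\<close> is injective on
  these words, so the induction hypothesis applies.
\<close>

lemma indep_graded:
  "indep_mod (Fil n) (\<lambda>(u, w). u * monomial w) (grouplikes \<times> {w \<in> ordered_words s I. length w = n})"
proof (induction n)
  case 0
  show ?case
  proof (rule indep_modI)
    fix F c p
    assume F: "finite F" "F \<subseteq> grouplikes \<times> {w \<in> ordered_words s I. length w = 0}"
      "(\<Sum>i\<in>F. scale (c i) (case i of (u, w) \<Rightarrow> u * monomial w)) \<in> Fil 0" "p \<in> F"
    have "(\<Sum>i\<in>F. scale (c i) (case i of (u, w) \<Rightarrow> u * monomial w)) = (\<Sum>i\<in>F. scale (c i) (fst i))"
      using F(2) by (intro sum.cong) auto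
    moreover have "inj_on fst F" using F(2) by (auto simp: inj_on_def)
    ultimately show "c p = 0"
      using F by (intro indep_mod_reindex[OF grouplikes_indep, of F fst c p]) (auto simp: Fil_0)
  qed
next
  case (Suc n)
  show ?case
  proof (rule indep_modI)
    fix F c p
    assume F: "finite F" "F \<subseteq> grouplikes \<times> {w \<in> ordered_words s I. length w = Suc n}"
      "(\<Sum>i\<in>F. scale (c i) (case i of (u, w) \<Rightarrow> u * monomial w)) \<in> Fil (Suc n)" "p \<in> F"
    obtain u0 w0 where p: "p = (u0, w0)" by (cases p)
    have u0: "u0 \<in> grouplikes" and w0: "w0 \<in> ordered_words s I" "length w0 = Suc n"
      using F p by auto
    \<comment> \<open>Any letter of \<open>w0\<close> would do.\<close>
    define i0 where "i0 = hd w0"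
    have i0: "i0 \<in> set w0" "i0 \<in> I"
      using w0 by (cases w0; auto simp: i0_def ordered_words_def)+
    obtain h where h: "functional h" "\<And>u. u \<in> C0 \<Longrightarrow> h u = 0"
      "\<And>r. r \<in> grouplikes \<times> I \<Longrightarrow> h (case r of (u, i) \<Rightarrow> u * y i) = (if r = (u0, i0) then 1 else 0)"
      using dual_functional[OF subspace_C0 base_indep, of "(u0, i0)"] u0 i0 by auto
    have hv: "vanishing h" using h by (simp add: vanishing_def)
    have h_dual: "h (u * y i) = (if u = u0 \<and> i = i0 then 1 else 0)" if "u \<in> grouplikes" "i \<in> I" for u i
      using h(3)[of "(u, i)"] that by simp
    define T where "T w = scale (del_coeff q i0 w) (u0 * g i0 * monomial (del_shift s i0 w))" for w
    define t where "t r = (if fst r = u0 \<and> i0 \<in> set (snd r) then T (snd r) else 0)" for r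
    have step: "slice h (case r of (u, w) \<Rightarrow> u * monomial w) - t r \<in> Fil n" if "r \<in> F" for r
    proof -
      obtain u w where r: "r = (u, w)" by (cases r)
      have u: "u \<in> grouplikes" and w: "w \<in> ordered_words s I" "length w = Suc n"
        using that F(2) r by auto
      let ?h = "\<lambda>z. h (u * z)"
      have wI: "i \<in> set w \<Longrightarrow> i \<in> I" for i using w by (auto simp: ordered_words_def)
      have "(\<Sum>i\<in>set w. scale (?h (y i) * del_coeff q i w) (g i * monomial (del_shift s i w)))
          = (\<Sum>i\<in>set w. if i = i0 then (if u = u0 then scale (del_coeff q i0 w) (g i0 * monomial (del_shift s i0 w)) else 0) else 0)"
        using u wI by (intro sum.cong) (auto simp: h_dual)
      also have "\<dots> = (if u = u0 \<and> i0 \<in> set w then scale (del_coeff q i0 w) (g i0 * monomial (del_shift s i0 w)) else 0)"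
        by (simp add: sum.delta)
      finally have "u * (\<Sum>i\<in>set w. scale (?h (y i) * del_coeff q i w) (g i * monomial (del_shift s i w))) = t r"
        by (auto simp: t_def T_def r scale_mult_right mult.assoc)
      moreover have "u * (slice ?h (monomial w) - (\<Sum>i\<in>set w. scale (?h (y i) * del_coeff q i w) (g i * monomial (del_shift s i w)))) \<in> Fil n"
        using slice_monomial[OF w(1) vanishing_mult_grouplike[OF hv u]] w(2) by (intro Fil_mult_grouplike u) simp
      ultimately show ?thesis
        by (simp add: r slice_mult_grouplike[OF h(1) u] right_diff_distrib)
    qed
    define F' where "F' = {r \<in> F. fst r = u0 \<and> i0 \<in> set (snd r)}"
    have "slice h (\<Sum>i\<in>F. scale (c i) (case i of (u, w) \<Rightarrow> u * monomial w)) \<in> Fil n"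
      by (rule slice_Fil_vanishing[OF F(3) hv])
    moreover have "(\<Sum>r\<in>F. scale (c r) (slice h (case r of (u, w) \<Rightarrow> u * monomial w) - t r)) \<in> Fil n"
      by (intro Fil_closed(3,4) step)
    ultimately have "slice h (\<Sum>i\<in>F. scale (c i) (case i of (u, w) \<Rightarrow> u * monomial w))
        - (\<Sum>r\<in>F. scale (c r) (slice h (case r of (u, w) \<Rightarrow> u * monomial w) - t r)) \<in> Fil n"
      by (rule Fil_closed)
    also have "slice h (\<Sum>i\<in>F. scale (c i) (case i of (u, w) \<Rightarrow> u * monomial w))
        - (\<Sum>r\<in>F. scale (c r) (slice h (case r of (u, w) \<Rightarrow> u * monomial w) - t r)) = (\<Sum>r\<in>F. scale (c r) (t r))"
      by (simp add: slice_sum[OF h(1)] slice_scale[OF h(1)] scale_right_diff_distrib sum_subtractf)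
    also have "\<dots> = (\<Sum>r\<in>F'. scale (c r) (t r))"
      using F(1) by (intro sum.mono_neutral_right) (auto simp: F'_def t_def)
    also have "\<dots> = (\<Sum>r\<in>F'. scale (c r * del_coeff q i0 (snd r))
        (case (u0 * g i0, del_shift s i0 (snd r)) of (u, w) \<Rightarrow> u * monomial w))"
      by (intro sum.cong) (auto simp: F'_def t_def T_def)
    finally have sum: "(\<Sum>r\<in>F'. scale (c r * del_coeff q i0 (snd r))
        (case (u0 * g i0, del_shift s i0 (snd r)) of (u, w) \<Rightarrow> u * monomial w)) \<in> Fil n" .
    have F'w: "snd r \<in> ordered_words s I" "length (snd r) = Suc n" "i0 \<in> set (snd r)" "fst r = u0"
      if "r \<in> F'" for r using that F(2) by (auto simp: F'_def)
    have "c p * del_coeff q i0 (snd p) = 0"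
    proof (rule indep_mod_reindex[OF Suc.IH _ _ _ sum])
      show "finite F'" using F(1) by (simp add: F'_def)
      show "inj_on (\<lambda>r. (u0 * g i0, del_shift s i0 (snd r))) F'"
      proof (rule inj_onI)
        fix r r' assume r: "r \<in> F'" "r' \<in> F'"
          "(u0 * g i0, del_shift s i0 (snd r)) = (u0 * g i0, del_shift s i0 (snd r'))"
        then have "snd r = snd r'"
          by (intro del_shift_inj[OF F'w(1) F'w(1) F'w(3) F'w(3) shift(1)]) auto
        then show "r = r'" using F'w(4) r by (simp add: prod_eq_iff)
      qed
      show "(\<lambda>r. (u0 * g i0, del_shift s i0 (snd r))) ` F' \<subseteq> grouplikes \<times> {w \<in> ordered_words s I. length w = n}"
        using F'w u0 i0 by (auto simp: length_del_shift mult_grouplike g_grouplike del_shift_ordered[OF _ _ shift])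
      show "p \<in> F'" using F(4) p i0 by (simp add: F'_def)
    qed
    then show "c p = 0" using coeff_nonzero[OF w0(1) i0(1)] p by simp
  qed
qed

text \<open>In a relation, the part of top degree \<open>n\<close> lies in \<open>Fil n\<close>, so \<open>indep_graded\<close> removes it.\<close>

lemma indep_monomials: "indep_mod {0} (\<lambda>(u, w). u * monomial w) (grouplikes \<times> ordered_words s I)"
proof (rule indep_modI)
  fix F c p
  let ?f = "\<lambda>(u, w). u * monomial w"
  have main: "\<forall>p\<in>F. c p = 0"
    if "finite F" "F \<subseteq> grouplikes \<times> ordered_words s I" "\<forall>p\<in>F. length (snd p) < n"
      "(\<Sum>i\<in>F. scale (c i) (?f i)) = 0" for n F
    using that
  proof (induction n arbitrary: F)
    case (Suc n)
    define A where "A = {p \<in> F. length (snd p) = n}"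
    define B where "B = {p \<in> F. length (snd p) < n}"
    have F: "F = A \<union> B" "A \<inter> B = {}" "finite A" "finite B"
      using Suc.prems by (auto simp: A_def B_def less_Suc_eq)
    have sum: "(\<Sum>i\<in>A. scale (c i) (?f i)) + (\<Sum>i\<in>B. scale (c i) (?f i)) = 0"
      using Suc.prems(4) F by (simp add: sum.union_disjoint)
    have "(\<Sum>i\<in>B. scale (c i) (?f i)) \<in> Fil n"
    proof (intro Fil_closed)
      fix i assume "i \<in> B"
      then obtain u w where i: "i = (u, w)" "u \<in> grouplikes" "set w \<subseteq> I" "length w < n"
        using Suc.prems(2) by (cases i) (auto simp: B_def ordered_words_def)
      then show "?f i \<in> Fil n" using Fil_word[OF monomial_word] by (simp add: Fil_mult_grouplike)
    qed
    moreover have "(\<Sum>i\<in>A. scale (c i) (?f i)) = 0 - (\<Sum>i\<in>B. scale (c i) (?f i))"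
      using sum by (simp only: diff_0 eq_neg_iff_add_eq_0)
    ultimately have "(\<Sum>i\<in>A. scale (c i) (?f i)) \<in> Fil n"
      using Fil_closed(2)[OF Fil_zero] by simp
    moreover have "A \<subseteq> grouplikes \<times> {w \<in> ordered_words s I. length w = n}"
      using Suc.prems(2) by (auto simp: A_def)
    ultimately have A: "c p = 0" if "p \<in> A" for p
      using F(3) that by (intro indep_modD[OF indep_graded])
    then have "(\<Sum>i\<in>A. scale (c i) (?f i)) = 0" by (intro sum.neutral) simp
    with sum have "(\<Sum>i\<in>B. scale (c i) (?f i)) = 0" by (simp only: add_0_left)
    moreover have "B \<subseteq> grouplikes \<times> ordered_words s I" "\<forall>p\<in>B. length (snd p) < n"
      using Suc.prems(2) by (auto simp: B_def)
    ultimately have "\<forall>p\<in>B. c p = 0" using F(4) by (intro Suc.IH)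
    with A F(1) show ?case by blast
  qed auto
  assume "finite F" "F \<subseteq> grouplikes \<times> ordered_words s I"
    "(\<Sum>i\<in>F. scale (c i) (?f i)) \<in> {0}" "p \<in> F"
  note F = this
  have len: "\<forall>p\<in>F. length (snd p) < Suc (Max ((length \<circ> snd) ` F))"
    using F(1) by (auto simp: less_Suc_eq_le)
  have "(\<Sum>i\<in>F. scale (c i) (?f i)) = 0" using F(3) by blast
  from main[OF F(1,2) len this] F(4) show "c p = 0" by blast
qed

lemma card_monomials_le_dim:
  assumes "A \<subseteq> grouplikes" "finite A" "Q \<subseteq> ordered_words s I" "finite Q"
    "\<And>u w. u \<in> A \<Longrightarrow> w \<in> Q \<Longrightarrow> u * monomial w \<in> V" "finite T" "V \<subseteq> span T"
  shows "card A * card Q \<le> dim V"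
proof -
  have "indep_mod {0} (\<lambda>(u, w). u * monomial w) (A \<times> Q)"
    using assms(1,3) by (intro indep_mod_subset[OF indep_monomials] Sigma_mono)
  then have "card (A \<times> Q) \<le> dim V"
    by (rule indep_mod_card_le_dim[where T = T]) (use assms in auto)
  then show ?thesis by (simp add: card_cartesian_product)
qed

end

section \<open>Growth\<close>

text \<open>A linear change of the length by the factor \<open>c\<close> does not matter, as \<open>ln n / ln (c n)\<close> tends to \<open>1\<close>.\<close>

lemma limsup_log_growth:
  fixes f F :: "nat \<Rightarrow> nat"
  assumes "c \<ge> 1" "\<And>n. f n \<ge> 1"
    and le: "\<forall>\<^sub>F n in sequentially. real (f n) * real n ^ m \<le> real (F (c * n))"
  shows "limsup (\<lambda>n. ereal (ln (real (f n)) / ln (real n))) + ereal (real m)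
    \<le> limsup (\<lambda>n. ereal (ln (real (F n)) / ln (real n)))"
proof -
  define u where "u n = ereal (ln (real n) / ln (real (c * n)))" for n
  define v where "v n = ereal (ln (real (f n)) / ln (real n))" for n
  define w where "w n = ereal (ln (real (F n)) / ln (real n))" for n
  have "(\<lambda>n. ln (real n) / ln (real c * real n)) \<longlonglongrightarrow> 1"
    using assms(1) by real_asymp
  then have u: "u \<longlonglongrightarrow> ereal 1"
    unfolding u_def by (intro tendsto_ereal) simp
  have "ereal (real m) + limsup v = limsup (\<lambda>n. ereal (real m) + v n)"
    by (rule ereal_limsup_lim_add[symmetric]) auto
  also have "\<dots> = ereal 1 * limsup (\<lambda>n. ereal (real m) + v n)"
    by (simp add: one_ereal_def[symmetric])
  also have "\<dots> = limsup (\<lambda>n. u n * (ereal (real m) + v n))"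
    by (rule ereal_limsup_lim_mult[OF u, symmetric]) auto
  also have "\<dots> \<le> limsup (\<lambda>n. w (c * n))"
  proof (rule Limsup_mono, use le eventually_gt_at_top[of 1] in eventually_elim)
    case (elim n)
    have "n \<le> c * n" using assms(1) by simp
    then have "1 < c * n" using elim(2) by linarith
    then have pos: "0 < ln (real n)" "0 < ln (real (c * n))"
      using elim(2) by (auto intro!: ln_gt_zero simp del: of_nat_mult)
    have f: "real (f n) \<ge> 1" using assms(2)[of n] by simp
    have "ln (real (f n)) + real m * ln (real n) = ln (real (f n) * real n ^ m)"
      using f elim by (subst ln_mult) (auto simp: ln_realpow)
    also have "\<dots> \<le> ln (real (F (c * n)))"
      using elim f by (intro ln_mono) auto
    finally have "(ln (real (f n)) + real m * ln (real n)) / ln (real (c * n))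
        \<le> ln (real (F (c * n))) / ln (real (c * n))"
      using pos by (intro divide_right_mono) auto
    moreover have "ln (real n) / ln (real (c * n)) * (real m + ln (real (f n)) / ln (real n))
        = (ln (real (f n)) + real m * ln (real n)) / ln (real (c * n))"
      using pos by (simp add: field_simps)
    ultimately have "ln (real n) / ln (real (c * n)) * (real m + ln (real (f n)) / ln (real n))
        \<le> ln (real (F (c * n))) / ln (real (c * n))" by (simp only:)
    then show ?case by (simp add: u_def v_def w_def del: of_nat_mult times_divide_eq_left)
  qed
  also have "\<dots> \<le> limsup w"
    using limsup_subseq_mono[of "\<lambda>n. c * n" w] assms(1) by (auto simp: strict_mono_def o_def)
  finally show ?thesis by (simp add: v_def[abs_def] w_def[abs_def] add.commute)
qed

context assoc_algebra
begin

lemma dim_mono_finite: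
  assumes "V \<subseteq> V'" "V' \<subseteq> span T" "finite T"
  shows "dim V \<le> dim V'"
proof -
  obtain B where B: "B \<subseteq> V" "independent B" "V \<subseteq> span B" "card B = dim V"
    by (rule basis_exists)
  obtain C where C: "C \<subseteq> V'" "independent C" "V' \<subseteq> span C" "card C = dim V'"
    by (rule basis_exists)
  have "finite C" using independent_span_bound[of T C] assms C by blast
  then have "card B \<le> card C" using independent_span_bound[of C B] assms B C by blast
  then show ?thesis using B C by simp
qed

definition words_upto :: "'a set \<Rightarrow> nat \<Rightarrow> 'a set" where
  "words_upto B n = {prod_list ws | ws. set ws \<subseteq> B \<and> length ws \<le> n}"

lemma finite_words_upto: "finite B \<Longrightarrow> finite (words_upto B n)"
proof -
  assume "finite B"
  then have "finite (prod_list ` {ws. set ws \<subseteq> B \<and> length ws \<le> n})"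
    by (intro finite_imageI finite_lists_length_le)
  then show ?thesis by (simp add: words_upto_def image_def conj_commute)
qed

lemma power_span_words: "power_span V n = span (words_upto V n)"
  by (simp add: power_span_def words_upto_def)

lemma prod_list_span:
  "set ws \<subseteq> span B \<Longrightarrow> prod_list ws \<in> span (words_upto B (length ws))"
proof (induction ws)
  case Nil
  have "1 \<in> words_upto B 0" by (auto simp: words_upto_def intro!: exI[of _ "[]"])
  then show ?case by (simp add: span_base)
next
  case (Cons a ws)
  let ?W = "words_upto B (length (a # ws))"
  have "b * prod_list ws \<in> span ?W" if b: "b \<in> B" for b
  proof (rule linear_span_into[OF linear_mult(1)])
    show "prod_list ws \<in> span (words_upto B (length ws))" using Cons by simp
    fix r assume "r \<in> words_upto B (length ws)"
    then obtain vs where "r = prod_list vs" "set vs \<subseteq> B" "length vs \<le> length ws"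
      by (auto simp: words_upto_def)
    then have "b * r \<in> ?W" using b unfolding words_upto_def by (auto intro!: exI[of _ "b # vs"])
    then show "b * r \<in> span ?W" by (rule span_base)
  qed
  then have "a * prod_list ws \<in> span ?W"
    using linear_span_into[OF linear_mult(2)[of "prod_list ws"], of B ?W a] Cons.prems by simp
  then show ?case by simp
qed

lemma power_span_span: "power_span (span B) n = span (words_upto B n)"
proof
  have "words_upto (span B) n \<subseteq> span (words_upto B n)"
  proof
    fix x assume "x \<in> words_upto (span B) n"
    then obtain ws where ws: "x = prod_list ws" "set ws \<subseteq> span B" "length ws \<le> n"
      by (auto simp: words_upto_def)
    have "words_upto B (length ws) \<subseteq> words_upto B n"
      using ws(3) by (auto simp: words_upto_def)
    then show "x \<in> span (words_upto B n)"
      using prod_list_span[OF ws(2)] ws(1) span_mono by blast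
  qed
  then show "power_span (span B) n \<subseteq> span (words_upto B n)"
    by (simp add: power_span_words span_minimal)
  have "words_upto B n \<subseteq> words_upto (span B) n"
    unfolding words_upto_def using span_superset[of B] by blast
  then show "span (words_upto B n) \<subseteq> power_span (span B) n"
    by (simp add: power_span_words span_mono)
qed

lemma one_le_dim_power_span: "finite B \<Longrightarrow> 1 \<le> dim (power_span (span B) n)"
proof -
  assume B: "finite B"
  have "dim {1 :: 'a} \<le> dim (power_span (span B) n)"
  proof (rule dim_mono_finite[OF _ _ finite_words_upto[OF B, of n]])
    have "1 \<in> words_upto B n" by (auto simp: words_upto_def intro!: exI[of _ "[]"])
    then show "{1} \<subseteq> power_span (span B) n" by (simp add: power_span_span span_base)
  qed (simp add: power_span_span)
  moreover have "dim {1 :: 'a} = card {1 :: 'a}"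
    by (rule dim_eq_card_independent) simp
  ultimately show ?thesis by simp
qed

lemma limsup_le_GKdim:
  assumes "finite B" "span B \<subseteq> A"
  shows "limsup (\<lambda>n. ereal (ln (real (dim (power_span (span B) n))) / ln (real n))) \<le> GKdim A"
  unfolding GKdim_def using assms by (intro SUP_upper2[of "span B"]) auto

lemma GKdim_nonneg: 
  assumes "0 \<in> A"
  shows "0 \<le> GKdim A"
proof -
  have dim: "dim (power_span (span {}) n) = 1" for n
  proof -
    have "dim (power_span (span {}) n) \<le> card (words_upto ({} :: 'a set) n)"
      by (rule dim_le_card[OF _ finite_words_upto[OF finite.emptyI]]) (simp only: power_span_span order_refl)
    also have "words_upto ({} :: 'a set) n = {1}" by (auto simp: words_upto_def)
    finally show ?thesis using one_le_dim_power_span[of "{}" n] by simp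
  qed
  have "limsup (\<lambda>n. ereal (ln (real (dim (power_span (span {}) n))) / ln (real n))) \<le> GKdim A"
    by (rule limsup_le_GKdim) (use assms in auto)
  then show ?thesis unfolding dim by (simp add: Limsup_const zero_ereal_def[symmetric])
qed

lemma finite_span_subset:
  assumes "finite B" "B \<subseteq> span S"
  obtains T where "finite T" "T \<subseteq> S" "B \<subseteq> span T"
proof -
  have "\<exists>T. finite T \<and> T \<subseteq> S \<and> b \<in> span T" if b: "b \<in> B" for b
  proof -
    have "b \<in> span ((\<lambda>x. x) ` S)" using assms(2) b by auto
    then obtain F c where "finite F" "F \<subseteq> S" "b = (\<Sum>i\<in>F. scale (c i) i)"
      using span_image_as_sum[of b "\<lambda>x. x" S] by blast
    then show ?thesis by (intro exI[of _ F]) (auto intro: span_sum span_scale span_base)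
  qed
  then obtain T where T: "\<And>b. b \<in> B \<Longrightarrow> finite (T b) \<and> T b \<subseteq> S \<and> b \<in> span (T b)" by metis
  show ?thesis
  proof (rule that[of "\<Union>b\<in>B. T b"])
    show "B \<subseteq> span (\<Union>b\<in>B. T b)"
      using T span_mono[of "T _" "\<Union>b\<in>B. T b"] by blast
  qed (use T assms(1) in auto)
qed

section \<open>Eigenvectors modulo a subspace\<close>

text \<open>The value of \<open>p(T)\<close> at a vector, for an endomorphism \<open>T\<close>.\<close>

definition poly_apply :: "('a \<Rightarrow> 'a) \<Rightarrow> 'k poly \<Rightarrow> 'a \<Rightarrow> 'a" where
  "poly_apply T p = fold_coeffs (\<lambda>a f x. scale a x + f (T x)) p (\<lambda>x. 0)"

lemma poly_apply_0 [simp]: "poly_apply T 0 x = 0"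
  by (simp add: poly_apply_def)

lemma poly_apply_pCons [simp]: "poly_apply T (pCons a p) x = scale a x + poly_apply T p (T x)"
  by (cases "p = 0 \<and> a = 0") (auto simp: poly_apply_def)

lemma poly_apply_add: "poly_apply T (p + r) x = poly_apply T p x + poly_apply T r x"
  by (induction p r arbitrary: x rule: poly_induct2) (simp_all add: scale_left_distrib algebra_simps)

lemma poly_apply_diff: "poly_apply T (p - r) x = poly_apply T p x - poly_apply T r x"
  using poly_apply_add[of T "p - r" r x] by simp

lemma poly_apply_smult: "poly_apply T (smult a p) x = scale a (poly_apply T p x)"
  by (induction p arbitrary: x) (simp_all add: scale_right_distrib)

lemma poly_apply_monom: "poly_apply T (monom a n) x = scale a ((T ^^ n) x)"
  by (induction n arbitrary: x) (simp_all add: monom_0 monom_Suc funpow_swap1)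

lemma poly_apply_sum: "poly_apply T (sum p F) x = (\<Sum>i\<in>F. poly_apply T (p i) x)"
  by (induction F rule: infinite_finite_induct) (simp_all add: poly_apply_add)

lemma poly_apply_linear:
  assumes "Vector_Spaces.linear scale scale T"
  shows "poly_apply T p (x - scale r z) = poly_apply T p x - scale r (poly_apply T p z)"
proof -
  interpret T: Vector_Spaces.linear scale scale T by fact
  show ?thesis
    by (induction p arbitrary: x z)
      (simp_all add: T.diff T.scale scale_right_diff_distrib scale_right_distrib mult.commute algebra_simps)
qed

end

text \<open>A linear relation modulo \<open>U\<close> between the iterates of \<open>z\<close> is a polynomial \<open>p\<close> with \<open>p(T) z \<in> U\<close>.  Splitting off
  a root \<open>r\<close> of \<open>p\<close>, either \<open>T z - r z\<close> lies in \<open>U\<close>, or it can replace \<open>z\<close> with a polynomial of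
  smaller degree.\<close>

lemma (in assoc_algebra) eigenvector_mod:
  assumes alg_closed: "\<And>p :: 'k poly. degree p > 0 \<Longrightarrow> \<exists>r. poly p r = 0"
    and T: "Vector_Spaces.linear scale scale T"
    and U: "subspace U" and E: "subspace E" "\<And>x. x \<in> E \<Longrightarrow> T x \<in> E"
    and z: "z \<in> E" "z \<notin> U" and not_indep: "\<not> indep_mod U (\<lambda>i. (T ^^ i) z) UNIV"
  obtains x r where "x \<in> E" "x \<notin> U" "T x - scale r x \<in> U"
proof -
  have main: "\<exists>x r. x \<in> E \<and> x \<notin> U \<and> T x - scale r x \<in> U"
    if "p \<noteq> 0" "z \<in> E" "z \<notin> U" "poly_apply T p z \<in> U" for p z
    using that
  proof (induction "degree p" arbitrary: p z rule: less_induct)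
    case less
    show ?case
    proof (cases "degree p = 0")
      case True
      then obtain a where a: "p = [:a:]" by (metis degree_eq_zeroE)
      have "scale a z \<in> U" using less.prems(4) by (simp add: a)
      from subspace_scale[OF U this, of "inverse a"] have "z \<in> U"
        using less.prems(1) by (simp add: a)
      then show ?thesis using less.prems by blast
    next
      case False
      then obtain r where "poly p r = 0" using alg_closed by blast
      then obtain p' where p': "p = [:- r, 1:] * p'" by (metis dvdE poly_eq_0_iff_dvd)
      then have "p' \<noteq> 0" using less.prems by auto
      then have "degree p' < degree p" unfolding p' by (subst degree_mult_eq) auto
      have "poly_apply T p z = poly_apply T p' (T z - scale r z)"
        by (simp add: p' poly_apply_add poly_apply_diff poly_apply_smult poly_apply_linear[OF T])
      then show ?thesis
        using less.hyps[OF \<open>degree p' < degree p\<close> \<open>p' \<noteq> 0\<close>, of "T z - scale r z"] less.prems E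
        by (metis subspace_diff subspace_scale)
    qed
  qed
  obtain F c j where F: "finite F" "(\<Sum>i\<in>F. scale (c i) ((T ^^ i) z)) \<in> U" "j \<in> F" "c j \<noteq> 0"
    using not_indep by (auto simp: indep_mod_def)
  define p where "p = (\<Sum>i\<in>F. monom (c i) i)"
  have "coeff p j = c j" using F by (simp add: p_def coeff_sum)
  then have "p \<noteq> 0" using F by auto
  moreover have "poly_apply T p z \<in> U" using F by (simp add: p_def poly_apply_sum poly_apply_monom)
  ultimately show ?thesis using main z that by blast
qed

section \<open>Conjugation by group-like elements\<close>

context hopf_algebra
begin

definition conjugate :: "'a \<Rightarrow> 'a \<Rightarrow> 'a" where
  "conjugate u x = S u * x * u"

lemma linear_conj: "Vector_Spaces.linear scale scale (conjugate u)"
  by unfold_locales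
    (simp_all add: conjugate_def distrib_left distrib_right scale_mult_left scale_mult_right)

lemma conjugate_add: "conjugate u (x + z) = conjugate u x + conjugate u z"
  and conjugate_diff: "conjugate u (x - z) = conjugate u x - conjugate u z"
  and conjugate_scale: "conjugate u (scale r x) = scale r (conjugate u x)"
  by (simp_all add: conjugate_def distrib_left distrib_right left_diff_distrib right_diff_distrib
      scale_mult_left scale_mult_right)

lemma mult_conj: "u \<in> grouplikes \<Longrightarrow> u * conjugate u x = x * u"
  by (simp add: conjugate_def antipode_grouplike flip: mult.assoc)

lemma conjugate_C0: "u \<in> grouplikes \<Longrightarrow> x \<in> C0 \<Longrightarrow> conjugate u x \<in> C0"
  unfolding conjugate_def by (intro C0_mult) (auto intro: grouplike_C0 inverse_grouplike)

lemma conjugate_C0_D: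
  assumes "u \<in> grouplikes" "conjugate u x \<in> C0"
  shows "x \<in> C0"
proof -
  have "x = u * conjugate u x * S u" using assms(1) by (simp add: mult_conj mult.assoc antipode_grouplike)
  also have "\<dots> \<in> C0" using assms by (intro C0_mult) (auto intro: grouplike_C0 inverse_grouplike)
  finally show ?thesis .
qed

lemma antipode_commute:
  assumes "u \<in> grouplikes" "v \<in> grouplikes" "u * v = v * u"
  shows "S u * S v = S v * S u"
proof -
  have "S u * S v = (S v * (S u * u) * v) * (S u * S v)"
    using assms by (simp add: antipode_grouplike)
  also have "\<dots> = S v * S u * (v * (u * S u) * S v)"
    using assms(3) by (metis mult.assoc)
  also have "\<dots> = S v * S u" using assms by (simp add: antipode_grouplike)
  finally show ?thesis .
qed

lemma conjugate_commute:
  assumes "u \<in> grouplikes" "v \<in> grouplikes" "u * v = v * u"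
  shows "conjugate u (conjugate v x) = conjugate v (conjugate u x)"
  using antipode_commute[OF assms] assms(3) unfolding conjugate_def by (metis mult.assoc)

text \<open>This is where commuting weights enter: conjugation by \<open>u\<close> changes the weight \<open>g\<close> to \<open>u\<^sup>-\<^sup>1 g u\<close>.\<close>

lemma has_weight_conj:
  assumes "u \<in> grouplikes" "u * g = g * u" "has_weight x g"
  shows "has_weight (conjugate u x) g"
proof -
  have u: "\<Delta> u \<doteq> tens u u" and Su: "\<Delta> (S u) \<doteq> tens (S u) (S u)"
    using assms(1) inverse_grouplike[OF assms(1)] by (auto simp: grouplikes_def)
  note x = assms(3)[unfolded has_weight_def]
  have "\<Delta> (S u * x) \<doteq> tensor_mult (tens (S u) (S u)) (tens x 1 + tens g x)"
    by (rule teq_trans[OF comult_mult tensor_mult_cong[OF Su x]])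
  then have "\<Delta> (conjugate u x) \<doteq> tensor_mult (tensor_mult (tens (S u) (S u)) (tens x 1 + tens g x)) (tens u u)"
    unfolding conjugate_def by (rule teq_trans[OF comult_mult tensor_mult_cong[OF _ u]])
  also have "\<dots> = tens (conjugate u x) 1 + tens (S u * (g * u)) (conjugate u x)"
    by (simp add: tensor_mult_simps conjugate_def antipode_grouplike[OF assms(1)] mult.assoc)
  also have "S u * (g * u) = g"
    using antipode_grouplike[OF assms(1)] by (simp flip: assms(2) mult.assoc)
  finally show ?thesis by (simp add: has_weight_def)
qed

lemma subspace_has_weight: "subspace {x. has_weight x g}"
proof (rule subspaceI)
  have "tens 0 1 + tens g 0 \<doteq> free_scale 0 (tens 0 1) + free_scale 0 (tens g 0)"
    using teq_tens_scale_left[of 0 0 1] teq_tens_scale_right[of g 0 0] by (intro teq_add) simp_all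
  moreover have "\<Delta> 0 \<doteq> 0" using comult_scale[of 0 0] by simp
  ultimately show "0 \<in> {x. has_weight x g}"
    by (simp add: has_weight_def) (meson teq_sym teq_trans)
next
  fix x z assume "x \<in> {x. has_weight x g}" "z \<in> {x. has_weight x g}"
  then have xz: "\<Delta> x \<doteq> tens x 1 + tens g x" "\<Delta> z \<doteq> tens z 1 + tens g z"
    by (simp_all add: has_weight_def)
  have "\<Delta> (x + z) \<doteq> (tens x 1 + tens g x) + (tens z 1 + tens g z)"
    by (intro teq_trans[OF comult_add] teq_add xz)
  also have "\<dots> = (tens x 1 + tens z 1) + (tens g x + tens g z)" by (simp add: algebra_simps)
  also have "\<dots> \<doteq> tens (x + z) 1 + tens g (x + z)"
    by (intro teq_add teq_sym[OF teq_tens_add_left] teq_sym[OF teq_tens_add_right])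
  finally show "x + z \<in> {x. has_weight x g}" by (simp add: has_weight_def)
next
  fix r x assume "x \<in> {x. has_weight x g}"
  then have "\<Delta> x \<doteq> tens x 1 + tens g x" by (simp add: has_weight_def)
  then have "\<Delta> (scale r x) \<doteq> free_scale r (tens x 1 + tens g x)"
    by (intro teq_trans[OF comult_scale] teq_scale)
  also have "\<dots> = free_scale r (tens x 1) + free_scale r (tens g x)" by (rule free.scale_right_distrib)
  also have "\<dots> \<doteq> tens (scale r x) 1 + tens g (scale r x)"
    by (intro teq_add teq_sym[OF teq_tens_scale_left] teq_sym[OF teq_tens_scale_right])
  finally show "scale r x \<in> {x. has_weight x g}" by (simp add: has_weight_def)
qed

lemma has_weight_one_minus:
  assumes "g \<in> grouplikes"
  shows "has_weight (1 - g) g"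
proof -
  have diff_l: "tens (a - a') b \<doteq> tens a b - tens a' b" for a a' b
    using teq_diff[OF teq_sym[OF teq_tens_add_left[of "a - a'" a' b]] teq_refl[of "tens a' b"]]
    by (simp add: teq_sym)
  have diff_r: "tens b (a - a') \<doteq> tens b a - tens b a'" for a a' b
    using teq_diff[OF teq_sym[OF teq_tens_add_right[of b "a - a'" a']] teq_refl[of "tens b a'"]]
    by (simp add: teq_sym)
  have "\<Delta> (1 - g) \<doteq> \<Delta> 1 - \<Delta> g"
    using teq_diff[OF teq_sym[OF comult_add[of "1 - g" g]] teq_refl[of "\<Delta> g"]] by (simp add: teq_sym)
  also have "\<dots> \<doteq> tens 1 1 - tens g g"
    using assms by (intro teq_diff comult_one) (simp add: grouplikes_def)
  also have "\<dots> = (tens 1 1 - tens g 1) + (tens g 1 - tens g g)" by simp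
  also have "\<dots> \<doteq> tens (1 - g) 1 + tens g (1 - g)"
    by (intro teq_add teq_sym[OF diff_l] teq_sym[OF diff_r])
  finally show ?thesis by (simp add: has_weight_def)
qed

text \<open>A functional that is \<open>1\<close> at the group-like \<open>1\<close> and \<open>0\<close> at all others, applied to the right tensor factor,
  turns the defining equation of \<open>z\<close> into the formula for \<open>z\<close>.\<close>

lemma skew_primitive_in_C0:
  assumes "has_weight z g" "g \<in> grouplikes" "z \<in> C0"
  obtains r where "z = scale r (1 - g)"
proof -
  obtain F c where F: "finite F" "F \<subseteq> grouplikes" "z = (\<Sum>u\<in>F. scale (c u) u)"
    using span_image_as_sum[of z "\<lambda>x. x" grouplikes] assms(3)
    unfolding C0_def image_ident by blast
  obtain f where f: "functional f" "\<And>u. u \<in> grouplikes \<Longrightarrow> f u = (if u = 1 then 1 else 0)"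
    by (rule dual_functional[OF subspace_single_0 grouplikes_indep one_grouplike]) blast
  have "slice f z = (\<Sum>u\<in>F. scale (c u * f u) u)"
    unfolding F(3) slice_sum[OF f(1)] using F(2)
    by (intro sum.cong) (auto simp: slice_scale[OF f(1)] slice_grouplike[OF f(1)])
  also have "\<dots> = scale (f z) 1"
  proof -
    have "(\<Sum>u\<in>F. scale (c u * f u) u) = (\<Sum>u\<in>F. if u = 1 then scale (c 1) 1 else 0)"
      using F(2) by (intro sum.cong) (auto simp: f(2))
    moreover have "f z = (\<Sum>u\<in>F. if u = 1 then c 1 else 0)"
      unfolding F(3) functional_sum[OF f(1)] functional_scale[OF f(1)]
      using F(2) by (intro sum.cong) (auto simp: f(2))
    ultimately show ?thesis using F(1) by (simp add: sum.delta)
  qed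
  finally have "z + scale (f z) g = scale (f z) 1"
    using slice_skew[OF f(1) assms(1)] f(2)[OF one_grouplike] by simp
  then have "z = scale (f z) (1 - g)" by (simp add: scale_right_diff_distrib algebra_simps)
  then show ?thesis by (rule that)
qed

end

section \<open>Independence of skew primitives modulo group-likes\<close>

context hopf_algebra
begin

text \<open>Slicing with a functional that singles out one group-like \<open>u\<^sub>0\<close> keeps, modulo \<open>C0\<close>, only the multiples of
  \<open>u\<^sub>0\<close> in a relation.\<close>

lemma indep_translates:
  assumes y: "\<And>i. i \<in> I \<Longrightarrow> has_weight (y i) (g i)" "\<And>i. i \<in> I \<Longrightarrow> g i \<in> grouplikes"
    and indep: "indep_mod C0 y I"
  shows "indep_mod C0 (\<lambda>(u, i). u * y i) (grouplikes \<times> I)"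
proof (rule indep_modI)
  fix F c p
  assume F: "finite F" "F \<subseteq> grouplikes \<times> I"
    "(\<Sum>r\<in>F. scale (c r) (case r of (u, i) \<Rightarrow> u * y i)) \<in> C0" "p \<in> F"
  obtain u0 i0 where p: "p = (u0, i0)" by (cases p)
  have u0: "u0 \<in> grouplikes" using F p by auto
  obtain h where h: "functional h" "\<And>u. u \<in> grouplikes \<Longrightarrow> h u = (if u = u0 then 1 else 0)"
    by (rule dual_functional[OF subspace_single_0 grouplikes_indep u0]) blast
  define t where "t r = (if fst r = u0 then u0 * y (snd r) else 0)" for r
  have slice_C0: "slice h x \<in> C0" if "x \<in> C0" for x
    using linear_span_into[OF linear_slice[OF h(1)], of grouplikes grouplikes x] that
    by (auto simp: C0_def slice_grouplike[OF h(1)] span_scale span_base)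
  have step: "slice h (case r of (u, i) \<Rightarrow> u * y i) - t r \<in> C0" if "r \<in> F" for r
  proof -
    obtain u i where r: "r = (u, i)" by (cases r)
    have ui: "u \<in> grouplikes" "i \<in> I" using that F(2) r by auto
    have "slice h (u * y i) = scale (h u) (u * y i) + scale (h (u * y i)) (u * g i)"
      using slice_mult_grouplike[OF h(1) ui(1)] slice_skew[OF functional_mult_left[OF h(1)] y(1)[OF ui(2)], of u]
      by (simp add: distrib_left scale_mult_right)
    moreover have "scale (h (u * y i)) (u * g i) \<in> C0"
      by (intro subspace_scale subspace_C0 grouplike_C0 mult_grouplike ui y)
    ultimately show ?thesis 
      by (cases "u = u0") (simp_all add: r t_def h(2)[OF ui(1)] h(2)[OF u0])
  qed
  have "slice h (\<Sum>r\<in>F. scale (c r) (case r of (u, i) \<Rightarrow> u * y i)) \<in> C0" by (rule slice_C0[OF F(3)])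
  moreover have "(\<Sum>r\<in>F. scale (c r) (slice h (case r of (u, i) \<Rightarrow> u * y i) - t r)) \<in> C0"
    by (intro subspace_sum subspace_scale subspace_C0 step)
  ultimately have "slice h (\<Sum>r\<in>F. scale (c r) (case r of (u, i) \<Rightarrow> u * y i))
      - (\<Sum>r\<in>F. scale (c r) (slice h (case r of (u, i) \<Rightarrow> u * y i) - t r)) \<in> C0"
    by (intro subspace_diff subspace_C0)
  also have "slice h (\<Sum>r\<in>F. scale (c r) (case r of (u, i) \<Rightarrow> u * y i))
      - (\<Sum>r\<in>F. scale (c r) (slice h (case r of (u, i) \<Rightarrow> u * y i) - t r)) = (\<Sum>r\<in>F. scale (c r) (t r))"
    by (simp add: slice_sum[OF h(1)] slice_scale[OF h(1)] scale_right_diff_distrib sum_subtractf)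
  also have "\<dots> = (\<Sum>r\<in>{r \<in> F. fst r = u0}. scale (c r) (t r))"
    using F(1) by (intro sum.mono_neutral_right) (auto simp: t_def)
  also have "\<dots> = u0 * (\<Sum>r\<in>{r \<in> F. fst r = u0}. scale (c r) (y (snd r)))"
    unfolding sum_distrib_left by (intro sum.cong) (auto simp: t_def scale_mult_right)
  finally have "S u0 * (u0 * (\<Sum>r\<in>{r \<in> F. fst r = u0}. scale (c r) (y (snd r)))) \<in> C0"
    using u0 by (intro C0_mult[OF grouplike_C0[OF inverse_grouplike]])
  then have sum: "(\<Sum>r\<in>{r \<in> F. fst r = u0}. scale (c r) (y (snd r))) \<in> C0"
    using antipode_grouplike[OF u0] by (simp flip: mult.assoc)
  show "c p = 0"
    by (rule indep_mod_reindex[OF indep _ _ _ sum]) (use F p in \<open>auto simp: inj_on_def\<close>)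
qed

text \<open>A slice that vanishes on \<open>C0\<close> turns a relation between the \<open>y\<^sub>i\<close> into one between their weights, which are
  linearly independent group-likes.\<close>

lemma indep_distinct_weights:
  assumes y: "\<And>i. i \<in> I \<Longrightarrow> has_weight (y i) (g i)" "\<And>i. i \<in> I \<Longrightarrow> g i \<in> grouplikes"
    "\<And>i. i \<in> I \<Longrightarrow> y i \<notin> C0" and inj: "inj_on g I"
  shows "indep_mod C0 y I"
proof (rule indep_modI)
  fix F c j
  assume F: "finite F" "F \<subseteq> I" "(\<Sum>i\<in>F. scale (c i) (y i)) \<in> C0" "j \<in> F"
  then have j: "j \<in> I" by auto
  obtain h where h: "functional h" "h (y j) = 1" "\<And>x. x \<in> C0 \<Longrightarrow> h x = 0"
    using separating_functional[of "y j" grouplikes] y(3)[OF j] unfolding C0_def by metis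
  have hv: "vanishing h" using h by (simp add: vanishing_def)
  have "slice h (\<Sum>i\<in>F. scale (c i) (y i)) \<in> Fil 0"
    using slice_Fil_vanishing[of _ 0, OF _ hv] F(3) Fil_1 by simp
  also have "slice h (\<Sum>i\<in>F. scale (c i) (y i)) = (\<Sum>i\<in>F. scale (c i * h (y i)) (g i))"
    unfolding slice_sum[OF h(1)] using F(2)
    by (intro sum.cong refl)
      (simp add: slice_scale[OF h(1)] slice_skew[OF h(1) y(1)] subset_iff h(3)[OF one_C0])
  finally have sum: "(\<Sum>i\<in>F. scale (c i * h (y i)) (g i)) \<in> {0}" by (simp add: Fil_0)
  have "c j * h (y j) = 0"
    by (rule indep_mod_reindex[OF grouplikes_indep _ _ _ sum])
      (use F y(2) inj in \<open>auto intro: inj_on_subset\<close>)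
  then show "c j = 0" using h(2) by simp
qed

end

text \<open>The occurrences of \<open>i\<close> in a sorted word are adjacent, so their contributions form a geometric sum with ratio
  \<open>q i i\<close>, multiplied by the factors from the smaller letters.\<close>

lemma del_coeff_nonzero:
  assumes q: "\<And>x. x \<in> set w \<Longrightarrow> q x i \<noteq> 0" "\<And>n. n > 0 \<Longrightarrow> qint (q i i) n \<noteq> 0"
    and w: "sorted w" "i \<in> set w"
  shows "del_coeff q i w \<noteq> 0"
proof -
  have "del_coeff q i w = (\<Prod>x\<leftarrow>filter (\<lambda>x. x < i) w. q x i) * qint (q i i) (count_list w i)"
    using w(1)
  proof (induction w)
    case (Cons x w)
    then have IH: "del_coeff q i w = (\<Prod>x\<leftarrow>filter (\<lambda>x. x < i) w. q x i) * qint (q i i) (count_list w i)"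
      by simp
    consider "x < i" | "x = i" | "x > i" by linarith
    then show ?case
    proof cases
      case 2
      then have "filter (\<lambda>x. x < i) w = []" using Cons.prems by (auto simp: filter_empty_conv)
      then show ?thesis using 2 IH by (simp add: qint_rec)
    next
      case 3
      then have "i \<notin> set w" using Cons.prems by auto
      moreover from this have "count_list w i = 0" by (simp add: count_list_0_iff)
      ultimately show ?thesis using 3 by (simp add: del_coeff_notin qint_simps)
    qed (simp add: IH)
  qed (simp add: qint_simps)
  moreover have "count_list w i > 0" using w(2) by (simp add: count_list_0_iff neq0_conv[symmetric] del: neq0_conv)
  moreover have "(\<Prod>x\<leftarrow>filter (\<lambda>x. x < i) w. q x i) \<noteq> 0"
    using q(1) by (auto simp: prod_list_zero_iff)
  ultimately show ?thesis using q(2) by simp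
qed

section \<open>Growth of the monomials in finitely many eigenvectors\<close>

text \<open>The sorted words \<open>0\<^sup>a 1\<^sup>b \<cdots>\<close> over \<open>m\<close> letters with all exponents at most \<open>n\<close>.\<close>

fun box_words :: "nat \<Rightarrow> nat \<Rightarrow> nat list set" where
  "box_words 0 n = {[]}"
| "box_words (Suc m) n = (\<lambda>(w, k). w @ replicate k m) ` (box_words m n \<times> {..n})"

lemma box_words:
  "w \<in> box_words m n \<Longrightarrow> sorted w \<and> set w \<subseteq> {..<m} \<and> length w \<le> m * n"
proof (induction m arbitrary: w)
  case (Suc m)
  then obtain v k where v: "w = v @ replicate k m" "v \<in> box_words m n" "k \<le> n" by auto
  with Suc.IH[OF v(2)] show ?case by (auto simp: sorted_append)
qed simp

lemma finite_box_words: "finite (box_words m n)"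
  by (induction m) auto

lemma card_box_words: "card (box_words m n) = (n + 1) ^ m"
proof (induction m)
  case (Suc m)
  have "inj_on (\<lambda>(w, k). w @ replicate k m) (box_words m n \<times> {..n})"
  proof (rule inj_onI, clarify)
    fix v k v' k'
    assume v: "v \<in> box_words m n" "v' \<in> box_words m n" and eq: "v @ replicate k m = v' @ replicate k' m"
    have "filter (\<lambda>x. x < m) (v @ replicate k m) = v" "filter (\<lambda>x. x < m) (v' @ replicate k' m) = v'"
      using box_words[OF v(1)] box_words[OF v(2)] by (auto simp: filter_id_conv subset_iff)
    then have "v = v'" using eq by metis
    then show "v = v' \<and> k = k'" using eq by (auto dest: arg_cong[of _ _ length])
  qed
  then show ?case by (simp add: card_image card_cartesian_product Suc.IH)
qed simp

text \<open>A finite-dimensional subspace of \<open>C0\<close> lies in the span of a finite set \<open>G0\<close> of group-likes.  The products of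
  at most \<open>n\<close> elements of \<open>G0\<close> are again group-like, so together with the \<open>(n + 1)\<^sup>m\<close> box monomials they give
  independent words of length at most \<open>(m + 1) n\<close> in \<open>G0\<close> and the \<open>y\<^sub>i\<close>.\<close>

lemma (in skew_family) GKdim_ge_monomials:
  assumes I: "I = {..<m}" and s: "s = 0"
  shows "GKdim C0 + ereal (real m) \<le> GKdim UNIV"
proof -
  have "limsup (\<lambda>n. ereal (ln (real (dim (power_span V n))) / ln (real n))) + ereal (real m) \<le> GKdim UNIV"
    if V: "V \<subseteq> C0" "finite B" "V = span B" for V B
  proof -
    have "B \<subseteq> span grouplikes" using V span_superset[of B] by (auto simp: C0_def)
    then obtain G0 where G0: "finite G0" "G0 \<subseteq> grouplikes" "B \<subseteq> span G0"
      using finite_span_subset[OF V(2)] by blast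
    define B' where "B' = G0 \<union> y ` {..<m}"
    have B': "finite B'" using G0 by (simp add: B'_def)
    have le: "real (dim (power_span V n)) * real n ^ m \<le> real (dim (power_span (span B') ((m + 1) * n)))"
      for n
    proof -
      let ?A = "words_upto G0 n"
      have prod: "prod_list ws \<in> grouplikes" if "set ws \<subseteq> G0" for ws
        using that G0(2) by (induction ws) (auto intro: one_grouplike mult_grouplike)
      have A: "?A \<subseteq> grouplikes" using prod by (auto simp: words_upto_def)
      have "span B \<subseteq> span G0" using G0(3) by (simp add: span_minimal)
      then have "words_upto V n \<subseteq> words_upto (span G0) n"
        using V(3) unfolding words_upto_def by blast
      then have "power_span V n \<subseteq> span ?A"
        using power_span_span[of G0 n] span_mono by (metis power_span_words)
      then have dimA: "dim (power_span V n) \<le> card ?A"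
        by (intro dim_le_card finite_words_upto G0)
      have "card ?A * card (box_words m n) \<le> dim (power_span (span B') ((m + 1) * n))"
      proof (rule card_monomials_le_dim[OF A finite_words_upto[OF G0(1)] _ finite_box_words])
        show "box_words m n \<subseteq> ordered_words s I"
          using box_words by (auto simp: ordered_words_def s I)
        fix u w assume "u \<in> ?A" "w \<in> box_words m n"
        then obtain ws where ws: "u = prod_list ws" "set ws \<subseteq> G0" "length ws \<le> n"
          and w: "set w \<subseteq> {..<m}" "length w \<le> m * n"
          using box_words by (auto simp: words_upto_def)
        have "u * monomial w = prod_list (ws @ map y w)" by (simp add: ws monomial_def)
        moreover have "set (ws @ map y w) \<subseteq> B'" "length (ws @ map y w) \<le> (m + 1) * n"
          using ws w by (auto simp: B'_def)
        ultimately have "u * monomial w \<in> words_upto B' ((m + 1) * n)"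
          unfolding words_upto_def by blast
        then show "u * monomial w \<in> power_span (span B') ((m + 1) * n)"
          by (simp add: power_span_span span_base)
      next
        show "finite (words_upto B' ((m + 1) * n))" by (rule finite_words_upto[OF B'])
        show "power_span (span B') ((m + 1) * n) \<subseteq> span (words_upto B' ((m + 1) * n))"
          by (simp add: power_span_span)
      qed
      moreover have "dim (power_span V n) * n ^ m \<le> card ?A * card (box_words m n)"
        unfolding card_box_words by (intro mult_mono dimA power_mono) auto
      ultimately have "dim (power_span V n) * n ^ m \<le> dim (power_span (span B') ((m + 1) * n))"
        by linarith
      then show ?thesis by (metis of_nat_le_iff of_nat_mult of_nat_power)
    qed
    have "limsup (\<lambda>n. ereal (ln (real (dim (power_span V n))) / ln (real n))) + ereal (real m)
        \<le> limsup (\<lambda>n. ereal (ln (real (dim (power_span (span B') n))) / ln (real n)))"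
      by (rule limsup_log_growth[of "m + 1"])
        (use le one_le_dim_power_span[OF V(2)] V(3) in \<open>auto simp del: mult_Suc\<close>)
    also have "\<dots> \<le> GKdim UNIV" by (rule limsup_le_GKdim[OF B']) simp
    finally show ?thesis .
  qed
  then have "GKdim C0 \<le> GKdim UNIV - ereal (real m)"
    unfolding GKdim_def[of C0] by (intro SUP_least) (auto simp: ereal_le_minus)
  then show ?thesis by (simp add: ereal_le_minus)
qed

lemma ereal_eq_infinity_nat:
  assumes "\<And>m. ereal (real m) \<le> x"
  shows "x = \<infinity>"
proof (rule ereal_top)
  fix B
  obtain m where "B \<le> real m" using real_arch_simple by blast
  then show "ereal B \<le> x" using assms[of m] by (meson ereal_less_eq(3) order_trans)
qed

section \<open>Conjugation orbits of infinite rank\<close>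

text \<open>Each subset of \<open>{..<n}\<close> gives an ordered monomial in the orbit elements.  These are products with
  indices up to \<open>n\<close>, but cancellation of neighbouring powers of \<open>u\<close> keeps their length below a
  multiple of \<open>n\<close>, so that the growth is exponential.\<close>

lemma (in skew_family) GKdim_infinite_orbit:
  assumes I: "I = UNIV" and u: "u \<in> grouplikes" and y: "\<And>i. y i = (conjugate u ^^ i) z"
  shows "GKdim UNIV = \<infinity>"
proof -
  note inv = antipode_grouplike[OF u]
  define B where "B = {S u, z, u}"
  have B: "finite B" by (simp add: B_def)
  have yi: "y i = S u ^ i * z * u ^ i" for i
    unfolding y
  proof (induction i)
    case (Suc i)
    then show ?case by (simp add: conjugate_def mult.assoc power_commutes)
  qed simp
  have pow: "u ^ i * S u ^ i = 1" for i
  proof (induction i)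
    case (Suc i)
    have "u ^ Suc i * S u ^ Suc i = u ^ i * (u * S u) * S u ^ i"
      by (simp only: power_Suc2[of u] power_Suc[of "S u"] mult.assoc)
    then show ?case using Suc inv by simp
  qed simp
  have pow': "S u ^ i * u ^ i = 1" for i
  proof (induction i)
    case (Suc i)
    have "S u ^ Suc i * u ^ Suc i = S u ^ i * (S u * u) * u ^ i"
      by (simp only: power_Suc2[of "S u"] power_Suc[of u] mult.assoc)
    then show ?case using Suc inv by simp
  qed simp
  \<comment> \<open>Neighbouring factors \<open>u\<^sup>i (S u)\<^sup>j\<close> of an ordered monomial telescope.\<close>
  have word: "\<exists>ws. set ws \<subseteq> B \<and> length ws \<le> n - a + length w \<and> u ^ a * monomial w = prod_list ws * u ^ n"
    if "a \<le> n" "sorted w" "set w \<subseteq> {a..<n}" for a w n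
    using that
  proof (induction w arbitrary: a)
    case Nil
    have "u ^ a = S u ^ (n - a) * (u ^ (n - a) * u ^ a)"
      using pow'[of "n - a"] by (simp flip: mult.assoc)
    also have "u ^ (n - a) * u ^ a = u ^ n" using Nil by (simp flip: power_add)
    finally show ?case
      by (intro exI[of _ "replicate (n - a) (S u)"]) (auto simp: B_def)
  next
    case (Cons i w)
    then have i: "a \<le> i" "i < n" by auto
    obtain ws where ws: "set ws \<subseteq> B" "length ws \<le> n - i + length w" "u ^ i * monomial w = prod_list ws * u ^ n"
      using Cons.IH[of i] Cons.prems i by (auto simp: subset_iff)
    have "u ^ a * S u ^ i = u ^ a * S u ^ a * S u ^ (i - a)"
      using i by (simp add: mult.assoc flip: power_add)
    then have "u ^ a * monomial (i # w) = S u ^ (i - a) * z * (u ^ i * monomial w)"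
      unfolding monomial_simps yi by (simp add: pow flip: mult.assoc)
    also have "\<dots> = prod_list (replicate (i - a) (S u) @ z # ws) * u ^ n"
      unfolding ws(3) by (simp add: mult.assoc)
    finally show ?case
      using ws i by (intro exI[of _ "replicate (i - a) (S u) @ z # ws"]) (auto simp: B_def)
  qed
  have le: "2 ^ n \<le> dim (power_span (span B) (3 * n))" for n :: nat
  proof -
    define Q where "Q = sorted_list_of_set ` Pow {..<n}"
    have "inj_on sorted_list_of_set (Pow {..<n})"
      by (rule inj_onI) (metis finite_lessThan finite_subset PowD set_sorted_list_of_set)
    then have "card Q = 2 ^ n" by (simp add: Q_def card_image card_Pow)
    have "card {1 :: 'a} * card Q \<le> dim (power_span (span B) (3 * n))"
    proof (rule card_monomials_le_dim)
      show "Q \<subseteq> ordered_words s I" by (auto simp: Q_def ordered_words_def I)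
      show "finite (words_upto B (3 * n))" by (rule finite_words_upto[OF B])
      show "power_span (span B) (3 * n) \<subseteq> span (words_upto B (3 * n))" by (simp add: power_span_span)
      fix v w assume "v \<in> {1 :: 'a}" "w \<in> Q"
      then obtain P where P: "P \<subseteq> {..<n}" "w = sorted_list_of_set P" "v = 1" by (auto simp: Q_def)
      have "finite P" using P(1) finite_subset by blast
      have "card P \<le> n" using card_mono[OF _ P(1)] by simp
      obtain ws where ws: "set ws \<subseteq> B" "length ws \<le> n + length w" "monomial w = prod_list ws * u ^ n"
        using word[of 0 n w] P \<open>finite P\<close> by (auto simp: atLeast0LessThan)
      have "v * monomial w = prod_list (ws @ replicate n u)" using ws(3) P(3) by simp
      moreover have "set (ws @ replicate n u) \<subseteq> B" "length (ws @ replicate n u) \<le> 3 * n"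
        using ws(1,2) P(2) \<open>card P \<le> n\<close> by (auto simp: B_def)
      ultimately have "v * monomial w \<in> words_upto B (3 * n)" unfolding words_upto_def by blast
      then show "v * monomial w \<in> power_span (span B) (3 * n)" by (simp add: power_span_span span_base)
    qed (auto simp: Q_def one_grouplike)
    then show ?thesis by (simp add: \<open>card Q = 2 ^ n\<close>)
  qed
  have "ereal (real m) \<le> GKdim UNIV" for m :: nat
  proof -
    have "(\<lambda>n. real n ^ m / 2 ^ n) \<longlonglongrightarrow> 0" by real_asymp
    then have "\<forall>\<^sub>F n in sequentially. real n ^ m / 2 ^ n < 1" by (rule order_tendstoD) simp
    then have "\<forall>\<^sub>F n in sequentially. real 1 * real n ^ m \<le> real (dim (power_span (span B) (3 * n)))"
    proof eventually_elim
      case (elim n)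
      then have "real n ^ m \<le> 2 ^ n" by (simp add: field_simps)
      also have "\<dots> \<le> real (dim (power_span (span B) (3 * n)))"
        using le[of n] by (metis of_nat_le_iff of_nat_numeral of_nat_power)
      finally show ?case by simp
    qed
    then have "limsup (\<lambda>n. ereal (ln (real 1) / ln (real n))) + ereal (real m)
        \<le> limsup (\<lambda>n. ereal (ln (real (dim (power_span (span B) n))) / ln (real n)))"
      by (intro limsup_log_growth[of 3 "\<lambda>_. 1"]) auto
    also have "\<dots> \<le> GKdim UNIV" by (rule limsup_le_GKdim[OF B]) simp
    finally show ?thesis by (simp add: Limsup_const zero_ereal_def[symmetric])
  qed
  then show ?thesis by (rule ereal_eq_infinity_nat)
qed

section \<open>Choosing simultaneous eigenvectors\<close>

locale hopf_algebra_alg_closed = hopf_algebra scale \<Delta> \<epsilon> S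
  for scale :: "'k::{alg_closed_field, field_char_0} \<Rightarrow> 'a::ring_1 \<Rightarrow> 'a" and \<Delta> \<epsilon> S
begin

lemma weights_grouplike: "g \<in> weights \<Longrightarrow> g \<in> grouplikes"
  unfolding weights_def skew_primitive_def using weight_eq weight_grouplike by fastforce

lemma qint_nonzero:
  assumes "q = 1 \<or> (\<forall>j>0. q ^ j \<noteq> 1)" "n > 0"
  shows "qint (q :: 'k) n \<noteq> 0"
proof (cases "q = 1")
  case True
  then show ?thesis using assms(2) by (simp add: qint_def)
next
  case False
  then show ?thesis using assms qint_telescope[of q n] by auto
qed

text \<open>If \<open>q\<close> were a primitive root of unity of order \<open>n > 1\<close>, then \<open>y\<close> could be corrected by an element of \<open>C0\<close> so that
  its \<open>n\<close>-th power is skew primitive or zero.\<close>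

lemma eigenvalue_not_root_of_unity:
  assumes g: "g \<in> grouplikes" "g \<notin> root_weights"
    and y: "has_weight y g" "y \<notin> C0" "conjugate g y - scale q y \<in> C0"
  shows "q = 1 \<or> (\<forall>j>0. q ^ j \<noteq> 1)"
proof (rule ccontr)
  assume "\<not> (q = 1 \<or> (\<forall>j>0. q ^ j \<noteq> 1))"
  then obtain j where q: "q \<noteq> 1" "j > 0" "q ^ j = 1" by auto
  have "has_weight (conjugate g y - scale q y) g"
    using has_weight_conj[OF g(1) refl y(1)] y(1) subspace_has_weight[of g]
    by (metis (mono_tags) mem_Collect_eq subspace_diff subspace_scale)
  then obtain r where r: "conjugate g y - scale q y = scale r (1 - g)"
    using skew_primitive_in_C0 g(1) y(3) by blast
  \<comment> \<open>As \<open>q \<noteq> 1\<close>, a multiple of \<open>1 - g\<close> corrects \<open>y\<close> to an honest eigenvector.\<close>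
  define t where "t = r / (q - 1)"
  define y' where "y' = y + scale t (1 - g)"
  have y'w: "has_weight y' g"
    using y(1) has_weight_one_minus[OF g(1)] subspace_has_weight[of g] unfolding y'_def
    by (metis (mono_tags) mem_Collect_eq subspace_add subspace_scale)
  have "scale t (1 - g) \<in> C0"
    using g(1) by (intro subspace_scale subspace_C0 subspace_diff one_C0 grouplike_C0)
  then have y'C0: "y' \<notin> C0" using y(2) subspace_diff[OF subspace_C0, of y' "scale t (1 - g)"]
    by (auto simp: y'_def)
  have "conjugate g (1 - g) = 1 - g"
    using antipode_grouplike[OF g(1)]
    by (simp add: conjugate_def left_diff_distrib right_diff_distrib)
  then have conj_t: "conjugate g (scale t (1 - g)) = scale t (1 - g)" by (simp only: conjugate_scale)
  have "conjugate g y = scale q y + scale r (1 - g)" using r by (simp only: diff_eq_eq add.commute)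
  then have "conjugate g y' = scale q y + scale (r + t) (1 - g)"
    by (simp only: y'_def conjugate_add conj_t scale_left_distrib add.assoc)
  also have "r + t = q * t" using q(1) by (simp add: t_def field_simps)
  finally have "conjugate g y' = scale q y'" by (simp add: y'_def scale_right_distrib)
  then have comm: "y' * g = scale q (g * y')"
    using mult_conj[OF g(1), of y'] by (simp add: scale_mult_right)
  define n where "n = (LEAST n. n > 0 \<and> q ^ n = 1)"
  have n: "n > 0" "q ^ n = 1" using LeastI[of "\<lambda>n. n > 0 \<and> q ^ n = 1" j] q by (auto simp: n_def)
  have prim: "q ^ i \<noteq> 1" if "0 < i" "i < n" for i
    using not_less_Least[of i "\<lambda>n. n > 0 \<and> q ^ n = 1"] that by (auto simp: n_def)
  have "n > 1" using n q(1) by (cases "n = 1") auto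
  have "has_weight (y' ^ n) (g ^ n)"
    by (rule has_weight_power_root_of_unity[OF y'w comm \<open>n > 1\<close> n(2) prim])
  then have "y' ^ n = 0 \<or> skew_primitive (y' ^ n)" by (auto simp: skew_primitive_def)
  moreover have "y' \<noteq> 0" using y'C0 subspace_C0 subspace_0 by blast
  ultimately have "weight y' \<in> root_weights"
    using y'w y'C0 \<open>n > 1\<close> by (auto simp: root_weights_def skew_primitive_def)
  then show False using weight_eq[OF y'w \<open>y' \<noteq> 0\<close>] g(2) by simp
qed

lemma eigenvalue_nonzero:
  assumes "u \<in> grouplikes" "y \<notin> C0" "conjugate u y - scale q y \<in> C0"
  shows "q \<noteq> 0"
  using assms conjugate_C0_D by auto

lemma has_weight_conj_funpow:
  "u \<in> grouplikes \<Longrightarrow> u * g = g * u \<Longrightarrow> has_weight z g \<Longrightarrow> has_weight ((conjugate u ^^ i) z) g"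
  by (induction i) (auto intro: has_weight_conj)

text \<open>Conjugation by \<open>g\<close> shifts the orbit, so an independent orbit would be a \<open>skew_family\<close>
  with \<open>s = 1\<close> and trivial scalars, and the dimension would be infinite.\<close>

lemma own_orbit_dependent:
  assumes g: "g \<in> grouplikes" "has_weight z g" "GKdim UNIV \<noteq> \<infinity>"
  shows "\<not> indep_mod C0 (\<lambda>i. (conjugate g ^^ i) z) UNIV"
proof
  assume indep: "indep_mod C0 (\<lambda>i. (conjugate g ^^ i) z) UNIV"
  interpret skew_family scale \<Delta> \<epsilon> S "\<lambda>i. (conjugate g ^^ i) z" "\<lambda>_. g" "\<lambda>_ _. 1" 1 UNIV
  proof
    show "(conjugate g ^^ x) z * g - scale 1 (g * (conjugate g ^^ (x + 1)) z) \<in> C0" for x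
      using mult_conj[OF g(1)] by (simp add: subspace_0[OF subspace_C0])
    show "indep_mod C0 (\<lambda>(u, i). u * (conjugate g ^^ i) z) (grouplikes \<times> UNIV)"
      by (rule indep_translates[OF _ _ indep]) (use g has_weight_conj_funpow in auto)
    show "del_coeff (\<lambda>_ _. 1 :: 'k) i w \<noteq> 0" if "w \<in> ordered_words 1 UNIV" "i \<in> set w" for i w
      using that by (intro del_coeff_nonzero qint_nonzero) (auto simp: ordered_words_def)
  qed (use g has_weight_conj_funpow in auto)
  show False using GKdim_infinite_orbit[OF refl g(1) refl] g(3) by simp
qed

text \<open>As \<open>u\<close> commutes with \<open>g\<close>, the whole orbit consists of eigenvectors for \<open>g\<close> with the same eigenvalue;
  if it were independent, it would be a \<open>skew_family\<close> with \<open>s = 0\<close>.\<close>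

lemma eigen_orbit_dependent:
  assumes g: "g \<in> grouplikes" "g \<notin> root_weights" "has_weight z g" "GKdim UNIV \<noteq> \<infinity>"
    and eig: "conjugate g z - scale q z \<in> C0" and u: "u \<in> grouplikes" "u * g = g * u"
  shows "\<not> indep_mod C0 (\<lambda>i. (conjugate u ^^ i) z) UNIV"
proof
  assume indep: "indep_mod C0 (\<lambda>i. (conjugate u ^^ i) z) UNIV"
  have zC0: "z \<notin> C0"
    using indep_modD[OF indep, of "{0}" "\<lambda>_. 1" 0] by auto
  have q: "q \<noteq> 0" "q = 1 \<or> (\<forall>j>0. q ^ j \<noteq> 1)"
    using eigenvalue_nonzero[OF g(1) zC0 eig] eigenvalue_not_root_of_unity[OF g(1,2,3) zC0 eig] by auto
  have orbit: "conjugate g ((conjugate u ^^ x) z) - scale q ((conjugate u ^^ x) z) \<in> C0" for x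
  proof (induction x)
    case (Suc x)
    have "conjugate g ((conjugate u ^^ Suc x) z) - scale q ((conjugate u ^^ Suc x) z)
        = conjugate u (conjugate g ((conjugate u ^^ x) z) - scale q ((conjugate u ^^ x) z))"
      by (simp add: conjugate_diff conjugate_scale conjugate_commute[OF u(1) g(1) u(2)])
    then show ?case using Suc.IH conjugate_C0 u(1) by simp
  qed (simp add: eig)
  interpret skew_family scale \<Delta> \<epsilon> S "\<lambda>i. (conjugate u ^^ i) z" "\<lambda>_. g" "\<lambda>_ _. q" 0 UNIV
  proof
    show "(conjugate u ^^ x) z * g - scale q (g * (conjugate u ^^ (x + 0)) z) \<in> C0" for x
    proof -
      have "g * (conjugate g ((conjugate u ^^ x) z) - scale q ((conjugate u ^^ x) z)) \<in> C0"
        by (intro C0_mult grouplike_C0 g(1) orbit)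
      then show ?thesis by (simp add: right_diff_distrib mult_conj[OF g(1)] scale_mult_right)
    qed
    show "indep_mod C0 (\<lambda>(v, i). v * (conjugate u ^^ i) z) (grouplikes \<times> UNIV)"
      by (rule indep_translates[OF _ _ indep]) (use g u has_weight_conj_funpow in auto)
    show "del_coeff (\<lambda>_ _. q) i w \<noteq> 0" if "w \<in> ordered_words 0 UNIV" "i \<in> set w" for i w
      using that q by (intro del_coeff_nonzero qint_nonzero) (auto simp: ordered_words_def)
  qed (use g u has_weight_conj_funpow in auto)
  show False using GKdim_infinite_orbit[OF refl u(1) refl] g(4) by simp
qed

text \<open>The space of skew primitives of weight \<open>g\<close> is cut down to eigenspaces modulo \<open>C0\<close> for one element of \<open>A\<close>
  after another.  Conjugation by \<open>g\<close> itself comes first, since the orbit argument for the other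
  elements of \<open>A\<close> starts from an eigenvector for \<open>g\<close>.\<close>

lemma simultaneous_eigenvector:
  assumes g: "g \<in> weights - root_weights" and fin: "GKdim UNIV \<noteq> \<infinity>"
    and us: "finite A" "A \<subseteq> grouplikes" "\<And>u v. u \<in> A \<Longrightarrow> v \<in> A \<Longrightarrow> u * v = v * u" "g \<in> A"
  obtains y where "has_weight y g" "y \<notin> C0" "\<forall>u\<in>A. \<exists>r. conjugate u y - scale r y \<in> C0"
proof -
  have gG: "g \<in> grouplikes" using g weights_grouplike by auto
  have alg: "\<exists>r. poly p r = 0" if "degree p > 0" for p :: "'k poly"
    using alg_closed_imp_poly_has_root[OF that] by blast
  define stable where "stable E \<longleftrightarrow> subspace E \<and> (\<forall>x\<in>E. has_weight x g) \<and> (\<forall>u\<in>A. \<forall>x\<in>E. conjugate u x \<in> E)" for E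
  have shrink: "stable {x \<in> E. conjugate u x - scale r x \<in> C0}" if E: "stable E" and u: "u \<in> A" for E u r
    unfolding stable_def
  proof (intro conjI ballI)
    interpret L: Vector_Spaces.linear scale scale "\<lambda>x. conjugate u x - scale r x"
      by unfold_locales
        (simp_all add: conjugate_add conjugate_scale scale_right_distrib scale_right_diff_distrib mult.commute)
    have "subspace (E \<inter> {x. conjugate u x - scale r x \<in> C0})"
      using E by (intro subspace_inter L.subspace_linear_preimage subspace_C0) (simp add: stable_def)
    then show "subspace {x \<in> E. conjugate u x - scale r x \<in> C0}" by (simp add: Int_def)
    fix v x assume v: "v \<in> A" and x: "x \<in> {x \<in> E. conjugate u x - scale r x \<in> C0}"
    have "conjugate u (conjugate v x) - scale r (conjugate v x) = conjugate v (conjugate u x - scale r x)"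
      using us u v by (simp add: conjugate_diff conjugate_scale conjugate_commute[of u v] subset_iff)
    also have "\<dots> \<in> C0" using x v us by (intro conjugate_C0) auto
    finally show "conjugate v x \<in> {x \<in> E. conjugate u x - scale r x \<in> C0}"
      using x v E by (simp add: stable_def)
  qed (use E in \<open>auto simp: stable_def\<close>)
  have eig: "\<exists>x r. x \<in> E \<and> x \<notin> C0 \<and> conjugate u x - scale r x \<in> C0"
    if E: "stable E" "u \<in> A" "z \<in> E" "z \<notin> C0" "\<not> indep_mod C0 (\<lambda>i. (conjugate u ^^ i) z) UNIV" for E u z
  proof -
    have sub: "subspace E" and closed: "\<And>x. x \<in> E \<Longrightarrow> conjugate u x \<in> E"
      using E(1,2) by (auto simp: stable_def)
    show ?thesis
      by (rule eigenvector_mod[OF alg linear_conj subspace_C0 sub closed E(3-5)]) blast+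
  qed
  obtain z where z: "skew_primitive z" "z \<notin> C0" "g = weight z" using g by (auto simp: weights_def)
  then obtain g' where "has_weight z g'" "z \<noteq> 0" by (auto simp: skew_primitive_def)
  then have zg: "has_weight z g" using weight_eq z(3) by metis
  have E0: "stable {x. has_weight x g}"
    unfolding stable_def using subspace_has_weight has_weight_conj us by auto
  then obtain x0 q where x0: "has_weight x0 g" "x0 \<notin> C0" "conjugate g x0 - scale q x0 \<in> C0"
    using eig[OF E0 us(4), of z] z(2) zg own_orbit_dependent[OF gG zg fin] by auto
  define E1 where "E1 = {x \<in> {x. has_weight x g}. conjugate g x - scale q x \<in> C0}"
  have E1: "stable E1" unfolding E1_def by (rule shrink[OF E0 us(4)])
  have "\<exists>y\<in>E. y \<notin> C0 \<and> (\<forall>u\<in>A'. \<exists>r. conjugate u y - scale r y \<in> C0)"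
    if "stable E" "E \<subseteq> E1" "z \<in> E" "z \<notin> C0" "A' \<subseteq> A" for E z A'
  proof -
    have "finite A'" using that us finite_subset by blast
    then show ?thesis using that
    proof (induction A' arbitrary: E z rule: finite_induct)
      case (insert u A')
      have u: "u \<in> A" using insert.prems by auto
      have z: "has_weight z g" "conjugate g z - scale q z \<in> C0" using insert.prems by (auto simp: E1_def)
      have "\<not> indep_mod C0 (\<lambda>i. (conjugate u ^^ i) z) UNIV"
        by (rule eigen_orbit_dependent[OF gG _ z(1) fin z(2)]) (use g u us in auto)
      then obtain x r where x: "x \<in> E" "x \<notin> C0" "conjugate u x - scale r x \<in> C0"
        using eig[OF insert.prems(1) u insert.prems(3,4)] by blast
      let ?E = "{x \<in> E. conjugate u x - scale r x \<in> C0}"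
      have xE: "x \<in> ?E" using x by simp
      have "\<exists>y\<in>?E. y \<notin> C0 \<and> (\<forall>u\<in>A'. \<exists>r. conjugate u y - scale r y \<in> C0)"
        by (rule insert.IH[OF shrink[OF insert.prems(1) u] _ xE x(2)]) (use insert.prems in auto)
      then show ?case by auto
    qed auto
  qed
  from this[OF E1 order_refl, of x0 A] x0 obtain y where
    "y \<in> E1" "y \<notin> C0" "\<forall>u\<in>A. \<exists>r. conjugate u y - scale r y \<in> C0" by (auto simp: E1_def)
  then show ?thesis by (intro that[of y]) (auto simp: E1_def)
qed

lemma GKdim_ge_card:
  assumes A: "finite A" "A \<subseteq> weights - root_weights"
    and comm: "\<And>u v. u \<in> A \<Longrightarrow> v \<in> A \<Longrightarrow> u * v = v * u"
    and fin: "GKdim UNIV \<noteq> \<infinity>"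
  shows "GKdim C0 + ereal (real (card A)) \<le> GKdim UNIV"
proof -
  have AG: "A \<subseteq> grouplikes" using A weights_grouplike by auto
  define m where "m = card A"
  obtain g where g: "bij_betw g {..<m} A"
    using ex_bij_betw_nat_finite[OF A(1)] by (auto simp: m_def atLeast0LessThan)
  have gA: "g i \<in> A" if "i < m" for i using bij_betwE[OF g] that by auto
  have "\<exists>y. has_weight y (g i) \<and> y \<notin> C0 \<and> (\<forall>u\<in>A. \<exists>r. conjugate u y - scale r y \<in> C0)" if "i < m" for i
    using simultaneous_eigenvector[OF _ fin A(1) AG comm gA[OF that]] gA[OF that] A(2) by blast
  then obtain y where y: "\<And>i. i < m \<Longrightarrow> has_weight (y i) (g i)" "\<And>i. i < m \<Longrightarrow> y i \<notin> C0"
    "\<And>i. i < m \<Longrightarrow> \<forall>u\<in>A. \<exists>r. conjugate u (y i) - scale r (y i) \<in> C0" by metis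
  have ex_q: "\<exists>r. conjugate (g i) (y x) - scale r (y x) \<in> C0" if "i < m" "x < m" for i x
    using y(3)[OF that(2)] gA[OF that(1)] by blast
  define q where "q x i = (SOME r. conjugate (g i) (y x) - scale r (y x) \<in> C0)" for x i
  have q: "conjugate (g i) (y x) - scale (q x i) (y x) \<in> C0" if "i < m" "x < m" for x i
    unfolding q_def by (rule someI_ex[OF ex_q[OF that]])
  have gG: "i < m \<Longrightarrow> g i \<in> grouplikes" for i using gA AG by auto
  interpret skew_family scale \<Delta> \<epsilon> S y g q 0 "{..<m}"
  proof
    fix i x assume ix: "i \<in> {..<m}" "x \<in> {..<m}"
    have "g i * (conjugate (g i) (y x) - scale (q x i) (y x)) \<in> C0"
      using ix by (intro C0_mult grouplike_C0 gG q) auto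
    then show "y x * g i - scale (q x i) (g i * y (x + 0)) \<in> C0"
      using ix by (simp add: right_diff_distrib mult_conj[OF gG] scale_mult_right)
  next
    have "indep_mod C0 y {..<m}"
      by (rule indep_distinct_weights[of _ _ g]) (use y gG g in \<open>auto simp: bij_betw_def\<close>)
    then show "indep_mod C0 (\<lambda>(u, i). u * y i) (grouplikes \<times> {..<m})"
      by (rule indep_translates[rotated 2]) (use y gG in auto)
  next
    fix w i assume w: "w \<in> ordered_words 0 {..<m}" "i \<in> set w"
    then have m: "\<And>x. x \<in> set w \<Longrightarrow> x < m" by (auto simp: ordered_words_def)
    have i: "i < m" using m w by auto
    show "del_coeff q i w \<noteq> 0"
    proof (rule del_coeff_nonzero[OF _ _ _ w(2)])
      show "sorted w" using w by (simp add: ordered_words_def)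
      show "q x i \<noteq> 0" if "x \<in> set w" for x
        using eigenvalue_nonzero[OF gG[OF i] y(2) q] m[OF that] i by blast
      have "g i \<notin> root_weights" using gA[OF i] A(2) by auto
      then show "qint (q i i) n \<noteq> 0" if "n > 0" for n
        by (intro qint_nonzero that eigenvalue_not_root_of_unity[OF gG[OF i] _ y(1)[OF i] y(2)[OF i] q[OF i i]])
    qed
  qed (use y gG in auto)
  show ?thesis using GKdim_ge_monomials[OF refl refl] by (simp add: m_def)
qed

end

theorem theorem0p3:
  fixes scale :: "'k::{alg_closed_field, field_char_0} \<Rightarrow> 'h::ring_1 \<Rightarrow> 'h"
    and \<Delta> :: "'h \<Rightarrow> ('h \<times> 'h \<Rightarrow>\<^sub>0 'k)"
    and \<epsilon> :: "'h \<Rightarrow> 'k"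
    and S :: "'h \<Rightarrow> 'h"
  defines "G \<equiv> hopf_algebra.grouplike_group scale \<Delta>"
    and "W \<equiv> hopf_algebra.weights scale \<Delta>"
    and "W_root \<equiv> hopf_algebra.root_weights scale \<Delta>"
    and "C\<^sub>0 \<equiv> hopf_algebra.C0 scale \<Delta>"
  assumes "hopf_algebra scale \<Delta> \<epsilon> S"
    and "comm_group (subgroup_generated G (W - W_root))"
  shows "assoc_algebra.GKdim scale UNIV \<ge> assoc_algebra.GKdim scale C\<^sub>0 + ext_card (W - W_root)"
proof -
  interpret H: hopf_algebra_alg_closed scale \<Delta> \<epsilon> S
    using assms(5) by (simp add: hopf_algebra_alg_closed_def)
  interpret comm_group "subgroup_generated G (W - W_root)" by fact
  have comm: "u * v = v * u" if "u \<in> W - W_root" "v \<in> W - W_root" for u v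
  proof -
    have "w \<in> carrier (subgroup_generated G (W - W_root))" if "w \<in> W - W_root" for w
      using that H.weights_grouplike unfolding carrier_subgroup_generated
      by (auto simp: G_def W_def H.grouplike_group_def intro!: generate.incl)
    from m_comm[OF this[OF that(1)] this[OF that(2)]] show ?thesis
      by (simp add: G_def H.grouplike_group_def)
  qed
  have bound: "H.GKdim C\<^sub>0 + ereal (real (card A)) \<le> H.GKdim UNIV"
    if "finite A" "A \<subseteq> W - W_root" "H.GKdim UNIV \<noteq> \<infinity>" for A
    unfolding C\<^sub>0_def using that comm
    by (intro H.GKdim_ge_card) (auto simp: W_def W_root_def)
  show ?thesis
  proof (cases "H.GKdim UNIV = \<infinity>")
    case False
    have "finite (W - W_root)"
    proof (rule ccontr)
      assume inf: "infinite (W - W_root)"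
      have "ereal (real m) \<le> H.GKdim UNIV" for m
      proof -
        obtain A where A: "finite A" "card A = m" "A \<subseteq> W - W_root"
          using infinite_arbitrarily_large[OF inf] by blast
        have "0 + ereal (real m) \<le> H.GKdim C\<^sub>0 + ereal (real (card A))"
          unfolding A(2) by (intro add_right_mono H.GKdim_nonneg) (simp add: C\<^sub>0_def H.subspace_0[OF H.subspace_C0])
        also have "\<dots> \<le> H.GKdim UNIV" by (rule bound[OF A(1,3) False])
        finally show ?thesis by simp
      qed
      then show False using False ereal_eq_infinity_nat by blast
    qed
    then show ?thesis using bound[of "W - W_root"] False by (simp add: ext_card_def)
  qed simp
qed

end
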